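(* Let $n,m$ be non-zero integers, let $w(x,y)=[x^n,y^m]$, and let $g\in \mathrm{SL}(2,\mathbb{C})$ have trace $\alpha\neq\pm 2$. Let $$S_g:=\{(x,y)\in \mathrm{SL}(2,\mathbb{C})\times \mathrm{SL}(2,\mathbb{C}) \ |\ w(x,y)=g\}.$$ Then the Makar-Limanov invariant satisfies $\mathrm{ML}(S_g)=\mathcal{O}(S_g)$, the ring of regular functions on $S_g$. In other words, $S_g$ admits no nontrivial $\mathbb{C}^+$-actions.
   Context: The commutator is $[a,b]=aba^{-1}b^{-1}$. $\mathbb{C}^+$ is the additive (algebraic) group of complex numbers. For an affine variety $X$ over $\mathbb{C}$ with ring of regular functions $A=\mathcal{O}(X)$, a locally nilpotent derivation of $A$ is a $\mathbb{C}$-linear map $\partial:A\to A$ with $\partial(ab)=\partial(a)b+a\partial(b)$ for all $a,b\in A$ and such that for every $a\in A$ there is $k\in\mathbb{N}$ with $\partial^k(a)=0$. Let $\mathrm{LND}(A)$ be the set of all locally nilpotent derivations of $A$. The Makar-Limanov invariant is $$\mathrm{ML}(X)=\bigcap_{\partial\in\mathrm{LND}(A)}\ker\partial ,$$ equivalently, the subring of those $f\in\mathcal{O}(X)$ that are invariant under all (algebraic) $\mathbb{C}^+$-actions on $X$. *)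

theory Defs
  imports "HOL-Analysis.Determinants" "HOL-Algebra.Group" "HOL-Library.Function_Algebras"
begin

definition SL2 :: "(complex^2^2) monoid" where
  "SL2 = \<lparr>carrier = {A. det A = 1}, mult = (**), one = mat 1\<rparr>"

lemma group_SL2: "group SL2"
proof (rule groupI)
  fix A assume "A \<in> carrier SL2"
  then have d: "det A = 1" by (simp add: SL2_def)
  then have "invertible A" by (simp add: invertible_det_nz)
  then obtain B where B: "A ** B = mat 1" "B ** A = mat 1"
    unfolding invertible_def by blast
  then have "det B * det A = 1" by (metis det_I det_mul)
  with d B show "\<exists>B\<in>carrier SL2. B \<otimes>\<^bsub>SL2\<^esub> A = \<one>\<^bsub>SL2\<^esub>"
    by (auto simp: SL2_def)
qed (auto simp: SL2_def det_mul matrix_mul_assoc)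

definition comm :: "('a, 'b) monoid_scheme \<Rightarrow> 'a \<Rightarrow> 'a \<Rightarrow> 'a" where
  "comm G a b = a \<otimes>\<^bsub>G\<^esub> b \<otimes>\<^bsub>G\<^esub> inv\<^bsub>G\<^esub> a \<otimes>\<^bsub>G\<^esub> inv\<^bsub>G\<^esub> b"

definition word :: "int \<Rightarrow> int \<Rightarrow> complex^2^2 \<Rightarrow> complex^2^2 \<Rightarrow> complex^2^2" where
  "word n m x y = comm SL2 (x [^]\<^bsub>SL2\<^esub> n) (y [^]\<^bsub>SL2\<^esub> m)"

definition word_fiber :: "int \<Rightarrow> int \<Rightarrow> complex^2^2 \<Rightarrow> ((complex^2^2) \<times> (complex^2^2)) set" where
  "word_fiber n m g = {(x, y). x \<in> carrier SL2 \<and> y \<in> carrier SL2 \<and> word n m x y = g}"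

text \<open>
  An affine variety is given as an algebraic subset \<open>X\<close> of an affine space, whose points form
  the type \<open>'p\<close> and whose coordinate functions form the set \<open>K\<close>.  The polynomial functions
  on the affine space are the elements of the \<open>\<complex>\<close>-algebra generated by \<open>K\<close>.
\<close>

inductive_set polynomial_functions :: "('p \<Rightarrow> complex) set \<Rightarrow> ('p \<Rightarrow> complex) set"
  for K :: "('p \<Rightarrow> complex) set" where
  const: "(\<lambda>_. c) \<in> polynomial_functions K"
| coord: "f \<in> K \<Longrightarrow> f \<in> polynomial_functions K"
| add: "f \<in> polynomial_functions K \<Longrightarrow> h \<in> polynomial_functions K \<Longrightarrow> f + h \<in> polynomial_functions K"
| mult: "f \<in> polynomial_functions K \<Longrightarrow> h \<in> polynomial_functions K \<Longrightarrow> f * h \<in> polynomial_functions K"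

text \<open>
  A function on \<open>X\<close> is represented by its extension by zero outside \<open>X\<close>.  Two regular
  functions are then equal iff they agree on \<open>X\<close>, and the ring operations are the pointwise
  ones; the unit is the indicator function of \<open>X\<close>.
\<close>

definition regular_functions :: "('p \<Rightarrow> complex) set \<Rightarrow> 'p set \<Rightarrow> ('p \<Rightarrow> complex) set" where
  "regular_functions K X = (\<lambda>p x. if x \<in> X then p x else 0) ` polynomial_functions K"

text \<open>
  The values of a derivation outside its domain \<open>A\<close> are irrelevant and left unconstrained.
\<close>

definition LND :: "('p \<Rightarrow> complex) set \<Rightarrow> (('p \<Rightarrow> complex) \<Rightarrow> ('p \<Rightarrow> complex)) set" where
  "LND A = {D. (\<forall>a\<in>A. D a \<in> A)
     \<and> (\<forall>a\<in>A. \<forall>b\<in>A. D (a + b) = D a + D b)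
     \<and> (\<forall>c. \<forall>a\<in>A. D ((\<lambda>_. c) * a) = (\<lambda>_. c) * D a)
     \<and> (\<forall>a\<in>A. \<forall>b\<in>A. D (a * b) = D a * b + a * D b)
     \<and> (\<forall>a\<in>A. \<exists>k. (D ^^ k) a = 0)}"

definition makar_limanov :: "('p \<Rightarrow> complex) set \<Rightarrow> 'p set \<Rightarrow> ('p \<Rightarrow> complex) set" where
  "makar_limanov K X = (\<Inter>D\<in>LND (regular_functions K X). {f \<in> regular_functions K X. D f = 0})"

text \<open>
  An algebraic \<open>\<complex>\<^sup>+\<close>-action on \<open>X\<close> is an action whose action map \<open>\<complex> \<times> X \<rightarrow> X\<close> is a morphism,
  that is, has regular coordinate functions.  The coordinates of the affine space containing
  \<open>\<complex> \<times> X\<close> are \<^term>\<open>fst\<close> and the functions \<open>f \<circ> snd\<close> for \<open>f\<close> in \<open>K\<close>.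
\<close>

definition additive_action ::
  "('p \<Rightarrow> complex) set \<Rightarrow> 'p set \<Rightarrow> (complex \<Rightarrow> 'p \<Rightarrow> 'p) \<Rightarrow> bool" where
  "additive_action K X \<phi> \<longleftrightarrow>
     (\<forall>t. \<forall>x\<in>X. \<phi> t x \<in> X)
     \<and> (\<forall>x\<in>X. \<phi> 0 x = x)
     \<and> (\<forall>s t. \<forall>x\<in>X. \<phi> (s + t) x = \<phi> s (\<phi> t x))
     \<and> (\<forall>f\<in>K. (\<lambda>(t, x). if x \<in> X then f (\<phi> t x) else 0)
           \<in> regular_functions (insert fst ((\<lambda>h. h \<circ> snd) ` K)) (UNIV \<times> X))"

definition matrix_pair_coords :: "((complex^2^2) \<times> (complex^2^2) \<Rightarrow> complex) set" where
  "matrix_pair_coords =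
     {f. \<exists>i j. f = (\<lambda>(x, y). x $ i $ j)} \<union> {f. \<exists>i j. f = (\<lambda>(x, y). y $ i $ j)}"

end

theory Submission
  imports Defs "HOL-Complex_Analysis.Conformal_Mappings"
begin

text \<open>
  Put \<open>a = x\<^sup>n\<close>, \<open>b = y\<^sup>m\<close>, \<open>s = tr a\<close>, \<open>u = tr b\<close>, \<open>v = tr (a b)\<close> and \<open>D = tr g + 2\<close>.  On the fibre,
  \<open>s\<^sup>2 + u\<^sup>2 + v\<^sup>2 - s u v = D\<close>, a smooth surface since \<open>D \<notin> {0, 4}\<close>, whose area form
  \<open>ds \<and> du / (2 v - s u)\<close> has only logarithmic poles at infinity.  Along an orbit of an action of the
  additive group the traces are polynomials in the time \<open>t\<close>.  Near a generic point their degrees are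
  locally constant.  If all three are positive, the area form evaluated on the velocity of the orbit and
  on any variation of the orbit is a polynomial in \<open>t\<close> that tends to zero, hence vanishes; since
  the twists \<open>b \<mapsto> b c\<close> with \<open>c\<close> commuting with \<open>a\<close>, and \<open>a \<mapsto> a c\<close> with \<open>c\<close> commuting with \<open>b\<close>,
  deform a generic point in two independent directions, the velocity is zero.  If one trace is
  constant, the other two lie on a smooth conic with two points at infinity and are constant as well.
  With constant traces the pair \<open>(a, b)\<close> can only move by conjugation with the torus centralising \<open>g\<close>,
  and there are no nonconstant polynomial maps to a torus.  So generic points are fixed, and by
  density all points are.  A locally nilpotent derivation \<open>\<partial>\<close> is reduced to this by the flow
  \<open>exp (t \<partial>)\<close>.
\<close>

section \<open>Polynomial functions and polynomial flows\<close>

lemma polynomial_functions_add [intro]: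
  "f \<in> polynomial_functions K \<Longrightarrow> h \<in> polynomial_functions K \<Longrightarrow> (\<lambda>x. f x + h x) \<in> polynomial_functions K"
  using polynomial_functions.add[of f K h] by (simp add: plus_fun_def)

lemma polynomial_functions_mult [intro]:
  "f \<in> polynomial_functions K \<Longrightarrow> h \<in> polynomial_functions K \<Longrightarrow> (\<lambda>x. f x * h x) \<in> polynomial_functions K"
  using polynomial_functions.mult[of f K h] by (simp add: times_fun_def)

lemma polynomial_functions_const [intro, simp]: "(\<lambda>_. c) \<in> polynomial_functions K"
  by (rule polynomial_functions.const)

lemma polynomial_functions_diff [intro]:
  assumes "f \<in> polynomial_functions K" "h \<in> polynomial_functions K"
  shows "(\<lambda>x. f x - h x) \<in> polynomial_functions K"
  using polynomial_functions_add[OF assms(1) polynomial_functions_mult[OF polynomial_functions_const[of "-1"] assms(2)]]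
  by simp

lemma polynomial_functions_sum [intro]:
  "(\<And>i. i \<in> I \<Longrightarrow> f i \<in> polynomial_functions K) \<Longrightarrow> (\<lambda>x. \<Sum>i\<in>I. f i x) \<in> polynomial_functions K"
  by (induction I rule: infinite_finite_induct) auto

lemma polynomial_functions_poly:
  assumes "f \<in> polynomial_functions K"
  shows "(\<lambda>x. poly q (f x)) \<in> polynomial_functions K"
  by (induction q) (use assms in auto)

lemma polynomial_functions_continuous:
  assumes "f \<in> polynomial_functions K" and "\<And>k. k \<in> K \<Longrightarrow> continuous_on UNIV k"
  shows "continuous_on UNIV f"
  using assms(1)
  by induction (auto simp: plus_fun_def times_fun_def intro: continuous_on_add continuous_on_mult assms(2))

lemma polynomial_functions_differentiable:
  assumes "f \<in> polynomial_functions K"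
    and "\<And>k. k \<in> K \<Longrightarrow> (\<lambda>z. k (\<gamma> z)) field_differentiable at z0"
  shows "(\<lambda>z. f (\<gamma> z)) field_differentiable at z0"
  using assms(1)
  by induction
    (auto simp: plus_fun_def times_fun_def intro: field_differentiable_add field_differentiable_mult assms(2))

text \<open>These are the polynomials in the time \<open>t\<close> over the ring of polynomial
  functions. The degree bound is uniform in \<open>p\<close>, so evaluation at a fixed
  \<open>t\<close> is a fixed finite sum of polynomial functions.\<close>

definition polynomial_family :: "('p \<Rightarrow> complex) set \<Rightarrow> ('p \<Rightarrow> complex poly) \<Rightarrow> bool" where
  "polynomial_family K c \<longleftrightarrow>
     (\<exists>N. \<forall>p. degree (c p) \<le> N) \<and> (\<forall>k. (\<lambda>p. coeff (c p) k) \<in> polynomial_functions K)"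

lemma polynomial_family_const:
  assumes "f \<in> polynomial_functions K"
  shows "polynomial_family K (\<lambda>p. [:f p:])"
  unfolding polynomial_family_def
proof (intro conjI allI exI[of _ 0])
  fix k show "(\<lambda>p. coeff [:f p:] k) \<in> polynomial_functions K"
    using assms by (cases k) auto
qed simp

lemma polynomial_family_X: "polynomial_family K (\<lambda>p. [:0, 1:])"
  unfolding polynomial_family_def by (auto intro: exI[of _ 1])

lemma polynomial_family_add:
  assumes "polynomial_family K c" "polynomial_family K d"
  shows "polynomial_family K (\<lambda>p. c p + d p)"
proof -
  obtain M N where "\<And>p. degree (c p) \<le> M" "\<And>p. degree (d p) \<le> N"
    using assms unfolding polynomial_family_def by blast
  then have "\<forall>p. degree (c p + d p) \<le> max M N"
    by (metis degree_add_le max.coboundedI1 max.coboundedI2)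
  then show ?thesis
    using assms unfolding polynomial_family_def by auto
qed

lemma polynomial_family_mult:
  assumes "polynomial_family K c" "polynomial_family K d"
  shows "polynomial_family K (\<lambda>p. c p * d p)"
proof -
  obtain M N where "\<And>p. degree (c p) \<le> M" "\<And>p. degree (d p) \<le> N"
    using assms unfolding polynomial_family_def by blast
  then have "\<forall>p. degree (c p * d p) \<le> M + N"
    by (meson add_mono degree_mult_le order_trans)
  then show ?thesis
    using assms unfolding polynomial_family_def coeff_mult
    by (intro conjI allI polynomial_functions_sum polynomial_functions_mult) blast+
qed

text \<open>Common ground of additive actions and exponentials of derivations. \<open>C f p\<close>
  follows \<open>f\<close> along the orbit only for \<open>p\<close> in \<open>X\<close>, but
  depends polynomially on \<open>p\<close> in the whole ambient space. Its coefficient at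
  \<open>1\<close> is the velocity of \<open>f\<close>, and \<open>flow_deriv\<close> is the group
  law in infinitesimal form.\<close>

locale polynomial_flow =
  fixes K :: "('p \<Rightarrow> complex) set" and X :: "'p set"
    and \<Phi> :: "complex \<Rightarrow> 'p \<Rightarrow> 'p" and C :: "('p \<Rightarrow> complex) \<Rightarrow> 'p \<Rightarrow> complex poly"
  assumes flow_in: "p \<in> X \<Longrightarrow> \<Phi> t p \<in> X"
    and flow_0: "p \<in> X \<Longrightarrow> \<Phi> 0 p = p"
    and flow_family: "f \<in> polynomial_functions K \<Longrightarrow> polynomial_family K (C f)"
    and flow_poly: "f \<in> polynomial_functions K \<Longrightarrow> p \<in> X \<Longrightarrow> f (\<Phi> t p) = poly (C f p) t"
    and flow_deriv: "f \<in> polynomial_functions K \<Longrightarrow> p \<in> X \<Longrightarrow>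
          poly (pderiv (C f p)) t = coeff (C f (\<Phi> t p)) 1"

text \<open>The coordinate \<open>fst\<close> becomes the variable \<open>t\<close>; every other
  coordinate is constant in \<open>t\<close>.\<close>

lemma polynomial_functions_product_family:
  assumes "h \<in> polynomial_functions (insert fst ((\<lambda>h. h \<circ> snd) ` K))"
  shows "\<exists>c. polynomial_family K c \<and> (\<forall>t p. h (t, p) = poly (c p) t)"
  using assms
proof induction
  case (const c)
  show ?case by (rule exI[of _ "\<lambda>_. [:c:]"]) (auto intro: polynomial_family_const)
next
  case (coord f)
  then consider "f = fst" | k where "k \<in> K" "f = k \<circ> snd" by auto
  then show ?case
  proof cases
    case 1
    then show ?thesis by (intro exI[of _ "\<lambda>_. [:0, 1:]"]) (auto intro: polynomial_family_X)
  next
    case 2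
    then show ?thesis
      by (intro exI[of _ "\<lambda>p. [:k p:]"]) (auto intro: polynomial_family_const polynomial_functions.coord)
  qed
next
  case (add f h)
  then obtain c d where "polynomial_family K c" "\<forall>t p. f (t, p) = poly (c p) t"
    "polynomial_family K d" "\<forall>t p. h (t, p) = poly (d p) t" by blast
  then show ?case
    by (intro exI[of _ "\<lambda>p. c p + d p"]) (auto intro: polynomial_family_add)
next
  case (mult f h)
  then obtain c d where "polynomial_family K c" "\<forall>t p. f (t, p) = poly (c p) t"
    "polynomial_family K d" "\<forall>t p. h (t, p) = poly (d p) t" by blast
  then show ?case
    by (intro exI[of _ "\<lambda>p. c p * d p"]) (auto intro: polynomial_family_mult)
qed

lemma additive_action_polynomial_flow:
  assumes act: "additive_action K X \<phi>"
  shows "\<exists>C. polynomial_flow K X \<phi> C"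
proof -
  have in_X: "\<phi> t x \<in> X" and zero: "\<phi> 0 x = x" and plus: "\<phi> (s + t) x = \<phi> s (\<phi> t x)"
    if "x \<in> X" for s t x
    using act that unfolding additive_action_def by auto
  have ex: "\<exists>c. polynomial_family K c \<and> (\<forall>p\<in>X. \<forall>t. f (\<phi> t p) = poly (c p) t)"
    if "f \<in> polynomial_functions K" for f
    using that
  proof induction
    case (const c)
    show ?case by (rule exI[of _ "\<lambda>_. [:c:]"]) (auto intro: polynomial_family_const)
  next
    case (coord f)
    then obtain h where h: "h \<in> polynomial_functions (insert fst ((\<lambda>h. h \<circ> snd) ` K))"
      and eq: "(\<lambda>(t, x). if x \<in> X then f (\<phi> t x) else 0) = (\<lambda>x. if x \<in> UNIV \<times> X then h x else 0)"
      using act unfolding additive_action_def regular_functions_def by blast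
    have "f (\<phi> t p) = h (t, p)" if "p \<in> X" for t p
      using fun_cong[OF eq, of "(t, p)"] that by simp
    then show ?case
      using polynomial_functions_product_family[OF h] by auto
  next
    case (add f h)
    then obtain c d where "polynomial_family K c" "\<forall>p\<in>X. \<forall>t. f (\<phi> t p) = poly (c p) t"
      "polynomial_family K d" "\<forall>p\<in>X. \<forall>t. h (\<phi> t p) = poly (d p) t" by blast
    then show ?case
      by (intro exI[of _ "\<lambda>p. c p + d p"]) (auto intro: polynomial_family_add)
  next
    case (mult f h)
    then obtain c d where "polynomial_family K c" "\<forall>p\<in>X. \<forall>t. f (\<phi> t p) = poly (c p) t"
      "polynomial_family K d" "\<forall>p\<in>X. \<forall>t. h (\<phi> t p) = poly (d p) t" by blast
    then show ?case
      by (intro exI[of _ "\<lambda>p. c p * d p"]) (auto intro: polynomial_family_mult)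
  qed
  then obtain C where C: "\<And>f. f \<in> polynomial_functions K \<Longrightarrow> polynomial_family K (C f)"
    "\<And>f p t. f \<in> polynomial_functions K \<Longrightarrow> p \<in> X \<Longrightarrow> f (\<phi> t p) = poly (C f p) t"
    by metis
  have "poly (pderiv (C f p)) t = coeff (C f (\<phi> t p)) 1"
    if f: "f \<in> polynomial_functions K" and p: "p \<in> X" for f p t
  proof -
    \<comment> \<open>The group law turns into a translation of the time variable; differentiating
      at \<open>r = 0\<close> then gives \<open>flow_deriv\<close>.\<close>
    have "poly (C f p \<circ>\<^sub>p [:t, 1:]) r = poly (C f (\<phi> t p)) r" for r
      using C(2)[OF f p, of "r + t"] C(2)[OF f in_X[OF p], of r t] plus[OF p, of r t]
      by (simp add: poly_pcompose add.commute)
    then have "C f p \<circ>\<^sub>p [:t, 1:] = C f (\<phi> t p)"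
      by (simp add: poly_eq_poly_eq_iff[symmetric] fun_eq_iff)
    then have "poly (pderiv (C f p \<circ>\<^sub>p [:t, 1:])) 0 = poly (pderiv (C f (\<phi> t p))) 0" by simp
    then show ?thesis
      by (simp add: pderiv_pcompose pderiv_pCons poly_pcompose poly_0_coeff_0 coeff_pderiv)
  qed
  then have "polynomial_flow K X \<phi> C"
    using C in_X zero by unfold_locales auto
  then show ?thesis by blast
qed

section \<open>Powers and commutators in SL(2)\<close>

lemma mat_mult_component [simp]: "(mat c ** A) $ i $ j = c * (A :: complex^'n^'m) $ i $ j"
  by (simp add: matrix_matrix_mult_def mat_def if_distrib[of "\<lambda>a. a * _"] sum.delta' cong: if_cong)

lemma mat_component: "mat c $ i $ j = (if i = j then c else 0)"
  by (simp add: mat_def)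

lemma mat_mult_commute: "mat c ** A = A ** mat (c::complex)" for A :: "complex^'n^'n"
  by (simp add: vec_eq_iff) (simp add: matrix_matrix_mult_def mat_def if_distrib[of "\<lambda>a. _ * a"] sum.delta cong: if_cong)

lemma trace_2: "trace A = A $ 1 $ 1 + A $ 2 $ 2" for A :: "complex^2^2"
  by (simp add: trace_def sum_2)

lemma mult_2_component: "(A ** B) $ i $ j = A $ i $ 1 * B $ 1 $ j + A $ i $ 2 * B $ 2 $ j"
  for A :: "complex^2^2"
  by (simp add: matrix_matrix_mult_def sum_2)

lemmas matrix_2_simps = vec_eq_iff forall_2 trace_2 det_2 mult_2_component mat_component

lemma SL2_carrier: "A \<in> carrier SL2 \<longleftrightarrow> det A = 1"
  by (simp add: SL2_def)

lemma SL2_mult: "A \<otimes>\<^bsub>SL2\<^esub> B = A ** B"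
  by (simp add: SL2_def)

lemma SL2_one: "\<one>\<^bsub>SL2\<^esub> = mat 1"
  by (simp add: SL2_def)

lemma cayley_hamilton_2: "A ** A = mat (trace A) ** A - mat (det A)" for A :: "complex^2^2"
  by (simp add: matrix_2_simps del: mat_mult_component) (simp add: mat_component algebra_simps)

lemma SL2_inv:
  assumes "det A = 1"
  shows "inv\<^bsub>SL2\<^esub> A = mat (trace A) - A"
proof (rule group.inv_equality[OF group_SL2])
  show "(mat (trace A) - A) \<otimes>\<^bsub>SL2\<^esub> A = \<one>\<^bsub>SL2\<^esub>"
    using assms by (simp add: SL2_mult SL2_one matrix_2_simps algebra_simps)
  show "A \<in> carrier SL2" "mat (trace A) - A \<in> carrier SL2"
    using assms by (simp_all add: SL2_carrier matrix_2_simps algebra_simps)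
qed

text \<open>Cayley-Hamilton reduces powers to \<open>\<alpha> x + \<beta>\<close> with
  Chebyshev-type polynomials in the trace. The quadratic identity expresses that the power has
  determinant \<open>1\<close>. The third identity says that the trace
  \<open>\<tau> \<alpha> + 2 \<beta>\<close> of the power has derivative \<open>k \<alpha>\<close>;
  the fourth is its companion in a simultaneous induction.\<close>

lemma SL2_nat_power:
  "\<exists>\<alpha> \<beta> :: complex poly.
     (\<forall>x. det x = 1 \<longrightarrow> x [^]\<^bsub>SL2\<^esub> k = mat (poly \<alpha> (trace x)) ** x + mat (poly \<beta> (trace x)))
   \<and> (\<forall>\<tau>. (poly \<alpha> \<tau>)\<^sup>2 + \<tau> * poly \<alpha> \<tau> * poly \<beta> \<tau> + (poly \<beta> \<tau>)\<^sup>2 = 1)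
   \<and> (\<forall>\<tau>. poly \<alpha> \<tau> + \<tau> * poly (pderiv \<alpha>) \<tau> + 2 * poly (pderiv \<beta>) \<tau> = of_nat k * poly \<alpha> \<tau>)
   \<and> (\<forall>\<tau>. 2 * poly (pderiv \<alpha>) \<tau> + \<tau> * poly (pderiv \<beta>) \<tau> = - of_nat k * poly \<beta> \<tau>)"
proof (induction k)
  case 0
  show ?case
    by (rule exI[of _ 0], rule exI[of _ 1]) (simp add: SL2_one matrix_2_simps)
next
  case (Suc k)
  then obtain \<alpha> \<beta> where IH:
    "\<And>x. det x = 1 \<Longrightarrow> x [^]\<^bsub>SL2\<^esub> k = mat (poly \<alpha> (trace x)) ** x + mat (poly \<beta> (trace x))"
    "\<And>\<tau>. (poly \<alpha> \<tau>)\<^sup>2 + \<tau> * poly \<alpha> \<tau> * poly \<beta> \<tau> + (poly \<beta> \<tau>)\<^sup>2 = 1"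
    "\<And>\<tau>. poly \<alpha> \<tau> + \<tau> * poly (pderiv \<alpha>) \<tau> + 2 * poly (pderiv \<beta>) \<tau> = of_nat k * poly \<alpha> \<tau>"
    "\<And>\<tau>. 2 * poly (pderiv \<alpha>) \<tau> + \<tau> * poly (pderiv \<beta>) \<tau> = - of_nat k * poly \<beta> \<tau>"
    by metis
  show ?case
  proof (rule exI[of _ "[:0, 1:] * \<alpha> + \<beta>"], rule exI[of _ "- \<alpha>"], intro conjI allI impI)
    fix x :: "complex^2^2" assume d: "det x = 1"
    define t where "t = trace x"
    have "x [^]\<^bsub>SL2\<^esub> Suc k = (mat (poly \<alpha> t) ** x + mat (poly \<beta> t)) ** x"
      using IH(1)[OF d] by (simp add: SL2_mult t_def)
    also have "\<dots> = mat (poly \<alpha> t) ** (x ** x) + mat (poly \<beta> t) ** x"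
      by (simp add: vec_eq_iff forall_2 mult_2_component mat_component algebra_simps)
    also have "\<dots> = mat (poly ([:0, 1:] * \<alpha> + \<beta>) t) ** x + mat (poly (- \<alpha>) t)"
      unfolding cayley_hamilton_2[of x] d t_def[symmetric]
      by (simp add: vec_eq_iff mat_component algebra_simps)
    finally show "x [^]\<^bsub>SL2\<^esub> Suc k
        = mat (poly ([:0, 1:] * \<alpha> + \<beta>) (trace x)) ** x + mat (poly (- \<alpha>) (trace x))"
      unfolding t_def .
  next
    fix \<tau>
    show "(poly ([:0, 1:] * \<alpha> + \<beta>) \<tau>)\<^sup>2 + \<tau> * poly ([:0, 1:] * \<alpha> + \<beta>) \<tau> * poly (- \<alpha>) \<tau>
        + (poly (- \<alpha>) \<tau>)\<^sup>2 = 1"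
      using IH(2)[of \<tau>] by (simp add: power2_eq_square algebra_simps)
    have "poly ([:0, 1:] * \<alpha> + \<beta>) \<tau> + \<tau> * poly (pderiv ([:0, 1:] * \<alpha> + \<beta>)) \<tau>
        + 2 * poly (pderiv (- \<alpha>)) \<tau>
      = poly ([:0, 1:] * \<alpha> + \<beta>) \<tau>
        + \<tau> * (poly \<alpha> \<tau> + \<tau> * poly (pderiv \<alpha>) \<tau> + 2 * poly (pderiv \<beta>) \<tau>)
        - (2 * poly (pderiv \<alpha>) \<tau> + \<tau> * poly (pderiv \<beta>) \<tau>)"
      by (simp add: pderiv_add pderiv_mult pderiv_pCons pderiv_minus algebra_simps)
    then show "poly ([:0, 1:] * \<alpha> + \<beta>) \<tau> + \<tau> * poly (pderiv ([:0, 1:] * \<alpha> + \<beta>)) \<tau>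
        + 2 * poly (pderiv (- \<alpha>)) \<tau> = of_nat (Suc k) * poly ([:0, 1:] * \<alpha> + \<beta>) \<tau>"
      unfolding IH(3,4) by (simp add: algebra_simps)
    have "2 * poly (pderiv ([:0, 1:] * \<alpha> + \<beta>)) \<tau> + \<tau> * poly (pderiv (- \<alpha>)) \<tau>
      = poly \<alpha> \<tau> + (poly \<alpha> \<tau> + \<tau> * poly (pderiv \<alpha>) \<tau> + 2 * poly (pderiv \<beta>) \<tau>)"
      by (simp add: pderiv_add pderiv_mult pderiv_pCons pderiv_minus algebra_simps)
    then show "2 * poly (pderiv ([:0, 1:] * \<alpha> + \<beta>)) \<tau> + \<tau> * poly (pderiv (- \<alpha>)) \<tau>
        = - of_nat (Suc k) * poly (- \<alpha>) \<tau>"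
      unfolding IH(3,4) by (simp add: algebra_simps)
  qed
qed

text \<open>\<open>\<tau> \<alpha> + 2 \<beta>\<close> is the trace of the power as a function of
  \<open>\<tau> = trace x\<close>. For \<open>n \<noteq> 0\<close> its derivative vanishes only
  where \<open>\<alpha>\<close> does, and there the power is scalar; elsewhere roots can be followed
  locally.\<close>

definition SL2_power_polys :: "int \<Rightarrow> complex poly \<Rightarrow> complex poly \<Rightarrow> bool" where
  "SL2_power_polys n \<alpha> \<beta> \<longleftrightarrow>
     (\<forall>x. det x = 1 \<longrightarrow> x [^]\<^bsub>SL2\<^esub> n = mat (poly \<alpha> (trace x)) ** x + mat (poly \<beta> (trace x)))
   \<and> (\<forall>\<tau>. (poly \<alpha> \<tau>)\<^sup>2 + \<tau> * poly \<alpha> \<tau> * poly \<beta> \<tau> + (poly \<beta> \<tau>)\<^sup>2 = 1)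
   \<and> (\<forall>\<tau>. ((\<lambda>\<tau>. \<tau> * poly \<alpha> \<tau> + 2 * poly \<beta> \<tau>) has_field_derivative of_int n * poly \<alpha> \<tau>) (at \<tau>))"

lemma SL2_power_polys_exist: "\<exists>\<alpha> \<beta>. SL2_power_polys n \<alpha> \<beta>"
proof -
  define k where "k = nat \<bar>n\<bar>"
  obtain \<alpha> \<beta> where nat:
    "\<And>x. det x = 1 \<Longrightarrow> x [^]\<^bsub>SL2\<^esub> k = mat (poly \<alpha> (trace x)) ** x + mat (poly \<beta> (trace x))"
    "\<And>\<tau>. (poly \<alpha> \<tau>)\<^sup>2 + \<tau> * poly \<alpha> \<tau> * poly \<beta> \<tau> + (poly \<beta> \<tau>)\<^sup>2 = 1"
    "\<And>\<tau>. poly \<alpha> \<tau> + \<tau> * poly (pderiv \<alpha>) \<tau> + 2 * poly (pderiv \<beta>) \<tau> = of_nat k * poly \<alpha> \<tau>"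
    using SL2_nat_power[of k] by metis
  have der: "((\<lambda>\<tau>. \<tau> * poly \<alpha> \<tau> + 2 * poly \<beta> \<tau>) has_field_derivative of_nat k * poly \<alpha> \<tau>) (at \<tau>)" for \<tau>
    unfolding nat(3)[symmetric] by (auto intro!: derivative_eq_intros)
  show ?thesis
  proof (cases "n \<ge> 0")
    case True
    then have "n = int k" by (simp add: k_def)
    then show ?thesis
      using nat(1,2) der unfolding SL2_power_polys_def
      by (intro exI[of _ \<alpha>] exI[of _ \<beta>]) (simp add: int_pow_int)
  next
    case False
    then have n: "n = - int k" by (simp add: k_def)
    \<comment> \<open>In determinant \<open>1\<close> the inverse is the trace minus the matrix, so
      \<open>\<alpha> x + \<beta>\<close> inverts to
      \<open>(\<tau> \<alpha> + 2 \<beta>) - (\<alpha> x + \<beta>)\<close>.\<close>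
    have "SL2_power_polys n (- \<alpha>) ([:0, 1:] * \<alpha> + \<beta>)"
      unfolding SL2_power_polys_def
    proof (intro conjI allI impI)
      fix x :: "complex^2^2" assume d: "det x = 1"
      then have "det (x [^]\<^bsub>SL2\<^esub> k) = 1"
        using monoid.nat_pow_closed[OF group.is_monoid[OF group_SL2], of x k] by (simp add: SL2_carrier)
      moreover have "x [^]\<^bsub>SL2\<^esub> n = inv\<^bsub>SL2\<^esub> (x [^]\<^bsub>SL2\<^esub> k)"
        using d group.int_pow_neg_int[OF group_SL2, of x k] by (simp add: n SL2_carrier)
      ultimately show "x [^]\<^bsub>SL2\<^esub> n
          = mat (poly (- \<alpha>) (trace x)) ** x + mat (poly ([:0, 1:] * \<alpha> + \<beta>) (trace x))"
        using nat(1)[OF d] by (simp add: SL2_inv vec_eq_iff forall_2 trace_2 mat_component algebra_simps)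
    next
      fix \<tau>
      show "(poly (- \<alpha>) \<tau>)\<^sup>2 + \<tau> * poly (- \<alpha>) \<tau> * poly ([:0, 1:] * \<alpha> + \<beta>) \<tau>
          + (poly ([:0, 1:] * \<alpha> + \<beta>) \<tau>)\<^sup>2 = 1"
        using nat(2)[of \<tau>] by (simp add: power2_eq_square algebra_simps)
      show "((\<lambda>\<tau>. \<tau> * poly (- \<alpha>) \<tau> + 2 * poly ([:0, 1:] * \<alpha> + \<beta>) \<tau>)
          has_field_derivative of_int n * poly (- \<alpha>) \<tau>) (at \<tau>)"
        using der[of \<tau>] by (simp add: n algebra_simps)
    qed
    then show ?thesis by blast
  qed
qed

lemma SL2_power_det: "det x = 1 \<Longrightarrow> det (x [^]\<^bsub>SL2\<^esub> (n::int)) = 1"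
  using group.int_pow_closed[OF group_SL2, of x n] by (simp add: SL2_carrier)

text \<open>Clearing inverses makes the equation of the fibre polynomial in the entries of the two
  powers.\<close>

lemma word_eq_iff:
  assumes "det x = 1" "det y = 1"
  shows "word n m x y = g \<longleftrightarrow>
    x [^]\<^bsub>SL2\<^esub> n ** y [^]\<^bsub>SL2\<^esub> m = g ** (y [^]\<^bsub>SL2\<^esub> m ** x [^]\<^bsub>SL2\<^esub> n)"
proof -
  define a b where "a = x [^]\<^bsub>SL2\<^esub> n" and "b = y [^]\<^bsub>SL2\<^esub> m"
  interpret group SL2 by (rule group_SL2)
  have ab: "a \<in> carrier SL2" "b \<in> carrier SL2"
    using assms by (simp_all add: a_def b_def SL2_carrier SL2_power_det)
  then have inv: "a ** inv\<^bsub>SL2\<^esub> a = mat 1" "inv\<^bsub>SL2\<^esub> a ** a = mat 1"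
    "b ** inv\<^bsub>SL2\<^esub> b = mat 1" "inv\<^bsub>SL2\<^esub> b ** b = mat 1"
    using r_inv l_inv by (simp_all add: SL2_mult SL2_one)
  have "word n m x y = a ** b ** inv\<^bsub>SL2\<^esub> a ** inv\<^bsub>SL2\<^esub> b"
    by (simp add: word_def comm_def a_def b_def SL2_mult)
  moreover have "a ** b ** inv\<^bsub>SL2\<^esub> a ** inv\<^bsub>SL2\<^esub> b = g \<longleftrightarrow> a ** b = g ** (b ** a)"
  proof -
    have cancel: "M ** a ** inv\<^bsub>SL2\<^esub> a = M" "M ** inv\<^bsub>SL2\<^esub> a ** a = M"
      "M ** b ** inv\<^bsub>SL2\<^esub> b = M" "M ** inv\<^bsub>SL2\<^esub> b ** b = M"
      for M :: "complex^2^2"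
      by (simp_all add: matrix_mul_assoc[symmetric] inv)
    show ?thesis
    proof
      assume "a ** b ** inv\<^bsub>SL2\<^esub> a ** inv\<^bsub>SL2\<^esub> b = g"
      then show "a ** b = g ** (b ** a)"
        by (auto simp: matrix_mul_assoc cancel)
    next
      assume "a ** b = g ** (b ** a)"
      then show "a ** b ** inv\<^bsub>SL2\<^esub> a ** inv\<^bsub>SL2\<^esub> b = g"
        by (simp add: matrix_mul_assoc cancel)
    qed
  qed
  ultimately show ?thesis by (simp add: a_def b_def)
qed

text \<open>Fricke's trace identity: the hypothesis says that \<open>g\<close> is the commutator of
  \<open>a\<close> and \<open>b\<close>, and both inverses are adjugates.\<close>

lemma trace_commutator_2:
  fixes a b g :: "complex^2^2"
  assumes "det a = 1" "det b = 1" "a ** b = g ** (b ** a)"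
  shows "(trace a)\<^sup>2 + (trace b)\<^sup>2 + (trace (a ** b))\<^sup>2 - trace a * trace b * trace (a ** b) = trace g + 2"
proof -
  have "g = g ** (b ** a) ** (mat (trace a) - a) ** (mat (trace b) - b)"
  proof -
    have "a ** (mat (trace a) - a) = mat 1" "b ** (mat (trace b) - b) = mat 1"
      using assms(1,2) by (simp_all add: matrix_2_simps algebra_simps)
    then have "M ** a ** (mat (trace a) - a) = M" "M ** b ** (mat (trace b) - b) = M"
      for M :: "complex^2^2"
      by (simp_all add: matrix_mul_assoc[symmetric])
    then show ?thesis by (simp add: matrix_mul_assoc)
  qed
  then have "trace g = trace (a ** b ** (mat (trace a) - a) ** (mat (trace b) - b))"
    unfolding assms(3) by (rule arg_cong)
  \<comment> \<open>Homogenised by determinants, the identity holds for all two by two matrices and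
    is pure expansion.\<close>
  moreover have "trace (a ** b ** (mat (trace a) - a) ** (mat (trace b) - b)) + 2 * (det a * det b)
      = (trace a)\<^sup>2 * det b + (trace b)\<^sup>2 * det a + (trace (a ** b))\<^sup>2 - trace a * trace b * trace (a ** b)"
    by (simp add: trace_2 det_2 mult_2_component mat_component power2_eq_square algebra_simps)
  ultimately show ?thesis using assms(1,2) by simp
qed

section \<open>Lifting roots and twisting pairs\<close>

lemma isCont_eventually_open:
  assumes "isCont f a" "open U" "f a \<in> U"
  shows "\<forall>\<^sub>F z in nhds a. f z \<in> U"
  using assms topological_tendstoD[of f "f a" "nhds a" U]
  by (simp add: isCont_def tendsto_at_iff_tendsto_nhds)

lemma isCont_eventually_nonzero:
  fixes f :: "complex \<Rightarrow> complex"
  assumes "isCont f a" "f a \<noteq> 0"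
  shows "\<forall>\<^sub>F z in nhds a. f z \<noteq> 0"
  using isCont_eventually_open[OF assms(1), of "- {0}"] assms(2) by (simp add: open_Compl)

text \<open>A root is determined by its trace \<open>\<tau>\<close> as
  \<open>(B - \<beta>) / \<alpha>\<close>. The trace is found by inverting \<open>P\<close>, the
  trace of the power, whose derivative \<open>n \<alpha>\<close> is nonzero at
  \<open>trace y\<close>.\<close>

lemma SL2_root_lift:
  assumes pp: "SL2_power_polys n \<alpha> \<beta>" and n: "n \<noteq> 0"
    and y: "det y = 1" and \<alpha>: "poly \<alpha> (trace y) \<noteq> 0"
    and B0: "B 0 = y [^]\<^bsub>SL2\<^esub> n" and detB: "\<forall>\<^sub>F z in nhds 0. det (B z) = 1"
    and diffB: "\<And>i j. (\<lambda>z. B z $ i $ j) field_differentiable at (0::complex)"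
  obtains Y where "Y 0 = y" "\<forall>\<^sub>F z in nhds 0. det (Y z) = 1 \<and> Y z [^]\<^bsub>SL2\<^esub> n = B z"
    "\<And>i j. (\<lambda>z. Y z $ i $ j) field_differentiable at 0"
proof -
  have power: "x [^]\<^bsub>SL2\<^esub> n = mat (poly \<alpha> (trace x)) ** x + mat (poly \<beta> (trace x))" if "det x = 1" for x
    using pp that unfolding SL2_power_polys_def by blast
  have quad: "(poly \<alpha> \<tau>)\<^sup>2 + \<tau> * poly \<alpha> \<tau> * poly \<beta> \<tau> + (poly \<beta> \<tau>)\<^sup>2 = 1" for \<tau>
    using pp unfolding SL2_power_polys_def by blast
  define P where "P = (\<lambda>\<tau>. \<tau> * poly \<alpha> \<tau> + 2 * poly \<beta> \<tau>)"
  have derP: "(P has_field_derivative of_int n * poly \<alpha> \<tau>) (at \<tau>)" for \<tau>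
    using pp unfolding SL2_power_polys_def P_def by blast
  define \<tau>0 where "\<tau>0 = trace y"
  have holP: "P holomorphic_on UNIV"
    using derP by (meson DERIV_imp_deriv field_differentiable_def holomorphic_onI field_differentiable_at_within)
  have "deriv P \<tau>0 \<noteq> 0"
    using DERIV_imp_deriv[OF derP[of \<tau>0]] n \<alpha> by (simp add: \<tau>0_def)
  then obtain r where r: "r > 0" "open (P ` ball \<tau>0 r)" "inj_on P (ball \<tau>0 r)"
    using has_complex_derivative_locally_invertible[OF holP UNIV_I open_UNIV, of \<tau>0] by auto
  obtain h where h: "h holomorphic_on (P ` ball \<tau>0 r)" "\<And>z. z \<in> ball \<tau>0 r \<Longrightarrow> h (P z) = z"
    using holomorphic_has_inverse[OF holomorphic_on_subset[OF holP subset_UNIV] open_ball r(3)] by metis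
  have P\<tau>0: "P \<tau>0 = trace (B 0)"
    unfolding B0 power[OF y] P_def \<tau>0_def by (simp add: trace_2 mat_component algebra_simps)
  define \<tau> where "\<tau> = (\<lambda>z. h (trace (B z)))"
  have mem: "trace (B 0) \<in> P ` ball \<tau>0 r" using r(1) P\<tau>0 by (metis centre_in_ball imageI)
  have diff_tr: "(\<lambda>z. trace (B z)) field_differentiable at 0"
    unfolding trace_2 by (intro field_differentiable_add diffB)
  have diff\<tau>: "\<tau> field_differentiable at 0"
    using field_differentiable_compose[OF diff_tr, of h] holomorphic_on_imp_differentiable_at[OF h(1) r(2) mem]
    by (simp add: \<tau>_def o_def)
  have \<tau>_0: "\<tau> 0 = \<tau>0"
    unfolding \<tau>_def P\<tau>0[symmetric] using h(2)[of \<tau>0] r(1) by simp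
  have diff\<alpha>: "(\<lambda>z. poly q (\<tau> z)) field_differentiable at 0" for q
    using diff\<tau> by (induction q) (auto intro!: derivative_intros)
  have "\<forall>\<^sub>F z in nhds 0. trace (B z) \<in> P ` ball \<tau>0 r"
    by (rule isCont_eventually_open[OF field_differentiable_imp_continuous_at[OF diff_tr] r(2) mem])
  moreover have "\<forall>\<^sub>F z in nhds 0. poly \<alpha> (\<tau> z) \<noteq> 0"
    by (rule isCont_eventually_nonzero[OF field_differentiable_imp_continuous_at[OF diff\<alpha>]])
      (simp add: \<alpha> \<tau>_0 \<tau>0_def[symmetric] \<alpha>[folded \<tau>0_def])
  ultimately have ev: "\<forall>\<^sub>F z in nhds 0. P (\<tau> z) = trace (B z) \<and> poly \<alpha> (\<tau> z) \<noteq> 0"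
    by eventually_elim (auto simp: \<tau>_def h(2))
  define Y where "Y = (\<lambda>z. mat (1 / poly \<alpha> (\<tau> z)) ** (B z - mat (poly \<beta> (\<tau> z))))"
  show thesis
  proof (rule that[of Y])
    show "Y 0 = y"
      using \<alpha> by (simp add: Y_def \<tau>_0 \<tau>0_def B0 power[OF y] vec_eq_iff mat_component)
    show "(\<lambda>z. Y z $ i $ j) field_differentiable at 0" for i j
      unfolding Y_def mat_mult_component vector_minus_component mat_component
      using \<alpha> by (cases "i = j") (auto simp: \<tau>_0 \<tau>0_def diffB diff\<alpha>
          intro!: field_differentiable_mult field_differentiable_divide field_differentiable_diff)
    show "\<forall>\<^sub>F z in nhds 0. det (Y z) = 1 \<and> Y z [^]\<^bsub>SL2\<^esub> n = B z"
      using ev detB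
    proof eventually_elim
      case (elim z)
      define a b where "a = poly \<alpha> (\<tau> z)" and "b = poly \<beta> (\<tau> z)"
      have a: "a \<noteq> 0" and tr: "\<tau> z * a + 2 * b = trace (B z)"
        using elim by (simp_all add: a_def b_def P_def)
      \<comment> \<open>The determinant comes out as \<open>1\<close> by the quadratic identity,
        once \<open>trace (B z)\<close> is written as \<open>\<tau> a + 2 b\<close>.\<close>
      have "a\<^sup>2 * det (Y z) = det (B z) - b * trace (B z) + b\<^sup>2"
        using a by (simp add: Y_def a_def[symmetric] b_def[symmetric] trace_2 det_2 mat_component
            field_simps power2_eq_square)
      also have "\<dots> = a\<^sup>2"
        using quad[of "\<tau> z"] elim by (simp add: tr[symmetric] a_def[symmetric] b_def[symmetric]
            algebra_simps power2_eq_square)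
      finally have det: "det (Y z) = 1" using a by simp
      have trY: "trace (Y z) = \<tau> z"
      proof -
        have "a * trace (Y z) = trace (B z) - 2 * b"
          using a by (simp add: Y_def a_def[symmetric] b_def[symmetric] trace_2 mat_component field_simps)
        then have "a * trace (Y z) = a * \<tau> z" by (simp add: tr[symmetric])
        then show ?thesis using a by simp
      qed
      have "Y z [^]\<^bsub>SL2\<^esub> n = B z"
        unfolding power[OF det] trY using a
        by (simp add: Y_def a_def[symmetric] b_def[symmetric] vec_eq_iff mat_component)
      with det show ?case by simp
    qed
  qed
qed

text \<open>
  The curve \<^term>\<open>c\<close> is \<open>(1 + z a) (1 + z a\<inverse>)\<inverse>\<close>, a one-parameter deformation of the identity in the
  centraliser of \<open>a\<close>; multiplying \<open>b\<close> by it changes neither \<open>trace a\<close> nor the commutator of \<open>a\<close> and \<open>b\<close>.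
\<close>

lemma twist_curve:
  fixes a b :: "complex^2^2"
  assumes a: "det a = 1"
  obtains c where "c 0 = mat 1" "\<forall>\<^sub>F z in nhds 0. det (c z) = 1" "\<And>z. a ** c z = c z ** a"
    "\<And>(M :: complex^2^2) i j. (\<lambda>z. (M ** c z) $ i $ j) field_differentiable at 0"
    "((\<lambda>z. trace (b ** c z)) has_field_derivative 2 * trace (a ** b) - trace a * trace b) (at 0)"
    "((\<lambda>z. trace (a ** (b ** c z))) has_field_derivative trace a * trace (a ** b) - 2 * trace b) (at 0)"
proof -
  define s where "s = trace a"
  \<comment> \<open>\<open>N z\<close> is the determinant of \<open>1 + z a\<inverse>\<close>, whose
    adjugate is \<open>1 + z a\<close>. The curve is therefore \<open>(1 + z a)^2 / N z\<close>, and
    Cayley-Hamilton for \<open>a\<close> gives the two coefficients below.\<close>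
  define N where "N = (\<lambda>z. 1 + z * s + z\<^sup>2)"
  define c where "c = (\<lambda>z. mat ((1 - z\<^sup>2) / N z) + mat ((2 * z + z\<^sup>2 * s) / N z) ** a)"
  have N0: "N 0 = 1" by (simp add: N_def)
  have derN: "(N has_field_derivative s) (at 0)"
    unfolding N_def by (auto intro!: derivative_eq_intros)
  have N: "\<forall>\<^sub>F z in nhds 0. N z \<noteq> 0"
    by (rule isCont_eventually_nonzero[OF DERIV_isCont[OF derN]]) (simp add: N0)
  have der1: "((\<lambda>z. (1 - z\<^sup>2) / N z) has_field_derivative - s) (at 0)"
    using derN by (auto intro!: derivative_eq_intros simp: N0)
  have der2: "((\<lambda>z. (2 * z + z\<^sup>2 * s) / N z) has_field_derivative 2) (at 0)"
    using derN by (auto intro!: derivative_eq_intros simp: N0)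
  have comp: "(M ** c z) $ i $ j = (1 - z\<^sup>2) / N z * M $ i $ j + (2 * z + z\<^sup>2 * s) / N z * (M ** a) $ i $ j"
    for M :: "complex^2^2" and z i j
    using exhaust_2[of j]
    by (auto simp: c_def mult_2_component mat_component algebra_simps)
  show thesis
  proof (rule that[of c])
    show "c 0 = mat 1" by (simp add: c_def N0 vec_eq_iff mat_component)
    show "a ** c z = c z ** a" for z
      by (simp add: c_def matrix_2_simps algebra_simps)
    show "\<forall>\<^sub>F z in nhds 0. det (c z) = 1"
      using N
    proof eventually_elim
      case (elim z)
      have "(N z)\<^sup>2 * det (c z) = (1 - z\<^sup>2)\<^sup>2 + (1 - z\<^sup>2) * (2 * z + z\<^sup>2 * s) * s + (2 * z + z\<^sup>2 * s)\<^sup>2 * det a"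
        using elim by (simp add: c_def det_2 s_def trace_2 mat_component field_simps power2_eq_square)
      also have "\<dots> = (N z)\<^sup>2" by (simp add: a N_def power2_eq_square algebra_simps)
      finally show ?case using elim by simp
    qed
    have der: "((\<lambda>z. (M ** c z) $ i $ j) has_field_derivative (- s * M $ i $ j + 2 * (M ** a) $ i $ j)) (at 0)"
      for M :: "complex^2^2" and i j unfolding comp by (rule derivative_eq_intros der1 der2 refl)+ simp
    then show "(\<lambda>z. (M ** c z) $ i $ j) field_differentiable at 0" for M :: "complex^2^2" and i j
      unfolding field_differentiable_def by blast
    have "((\<lambda>z. trace (b ** c z)) has_field_derivative (- s * trace b + 2 * trace (b ** a))) (at 0)"
      unfolding trace_2 by (rule DERIV_cong[OF DERIV_add[OF der der]]) (simp add: algebra_simps)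
    then show "((\<lambda>z. trace (b ** c z)) has_field_derivative 2 * trace (a ** b) - trace a * trace b) (at 0)"
      by (simp add: s_def trace_mul_sym[of b a])
    have "((\<lambda>z. trace (a ** b ** c z)) has_field_derivative (- s * trace (a ** b) + 2 * trace (a ** b ** a))) (at 0)"
      unfolding trace_2 by (rule DERIV_cong[OF DERIV_add[OF der der]]) (simp add: algebra_simps)
    moreover have "trace (a ** b ** a) = s * trace (a ** b) - trace b * det a"
      by (simp add: s_def trace_2 det_2 mult_2_component algebra_simps)
    ultimately show "((\<lambda>z. trace (a ** (b ** c z)))
        has_field_derivative trace a * trace (a ** b) - 2 * trace b) (at 0)"
      by (simp add: s_def a matrix_mul_assoc algebra_simps)
  qed
qed

section \<open>Polynomial curves on the trace surface\<close>

lemma poly_ext: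
  fixes p q :: "complex poly"
  assumes "\<And>t. poly p t = poly q t"
  shows "p = q"
  using assms by (simp add: poly_eq_poly_eq_iff[symmetric] fun_eq_iff)

lemma degree_mult_const_eq_0:
  fixes p q :: "complex poly"
  assumes "p * q = [:c:]" "c \<noteq> 0"
  shows "degree p = 0" "degree q = 0"
proof -
  have "p \<noteq> 0" "q \<noteq> 0" using assms by auto
  then have "degree p + degree q = 0" using degree_mult_eq[of p q] assms(1) by simp
  then show "degree p = 0" "degree q = 0" by simp_all
qed

text \<open>
  On the surface \<open>s\<^sup>2 + u\<^sup>2 + v\<^sup>2 - s u v = D\<close> the number \<open>4 D (D - 4)\<close> lies in the ideal generated by the
  partial derivatives, so the surface is smooth for \<open>D \<notin> {0, 4}\<close>.
\<close>

lemma markov_gradient_bezout: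
  fixes s u v D :: "'a :: comm_ring_1"
  assumes "s\<^sup>2 + u\<^sup>2 + v\<^sup>2 - s * u * v = D"
  defines "X \<equiv> 2 * s - u * v" and "Y \<equiv> 2 * u - s * v" and "Z \<equiv> 2 * v - s * u"
  shows "(2 * s * (s\<^sup>2 - 4)) * X + (2 * s * (Z - 2 * v) + u * (4 * D - 8 - (u * Y + v * Z))) * Y
      + (- 4 * s * u + v * (4 * D - 8 - (u * Y + v * Z))) * Z = 4 * D * (D - 4)"
  unfolding assms(1)[symmetric] X_def Y_def Z_def by (simp add: algebra_simps power2_eq_square)

text \<open>Up to sign, \<open>W = V - S * U\<close> is the other root of the equation read as a
  quadratic in \<open>V\<close>, and \<open>V * W\<close> has degree at most twice the larger of
  \<open>degree S\<close> and \<open>degree U\<close>. As \<open>V\<close> has the largest degree,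
  the leading terms of \<open>V\<close> and \<open>S * U\<close> must cancel in \<open>W\<close>;
  then \<open>2 * V - S * U = V + W\<close> keeps the degree of \<open>V\<close>.\<close>

lemma markov_degree:
  fixes S U V :: "complex poly"
  assumes eq: "S\<^sup>2 + U\<^sup>2 + V\<^sup>2 - S * U * V = [:D:]"
    and pos: "degree S > 0" "degree U > 0" and max: "degree S \<le> degree V" "degree U \<le> degree V"
  shows "degree V = degree S + degree U" "degree (2 * V - S * U) = degree V"
proof -
  define W where "W = V - S * U"
  have VW: "V * W = [:D:] - S\<^sup>2 - U\<^sup>2"
    using eq by (simp add: W_def algebra_simps power2_eq_square)
  have SU: "degree (S * U) = degree S + degree U"
    using pos by (intro degree_mult_eq) auto
  have "degree ([:D:] - S\<^sup>2 - U\<^sup>2) \<le> 2 * Max {degree S, degree U}"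
  proof (intro degree_diff_le)
    show "degree (S\<^sup>2) \<le> 2 * Max {degree S, degree U}" "degree (U\<^sup>2) \<le> 2 * Max {degree S, degree U}"
      using degree_power_le[of S 2] degree_power_le[of U 2] by (simp_all add: mult.commute)
  qed simp
  then have le: "degree V + degree W \<le> 2 * Max {degree S, degree U}" if "W \<noteq> 0"
  proof -
    have "V \<noteq> 0" using pos max by auto
    then show ?thesis using degree_mult_eq[of V W] that \<open>degree ([:D:] - S\<^sup>2 - U\<^sup>2) \<le> _\<close> by (simp add: VW)
  qed
  show dV: "degree V = degree S + degree U"
  proof (rule ccontr)
    assume ne: "degree V \<noteq> degree S + degree U"
    have "degree W = Max {degree V, degree S + degree U}"
    proof (cases "degree V < degree (S * U)")
      case True
      then show ?thesis unfolding W_def using degree_add_eq_right[of V "- (S * U)"] SU by simp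
    next
      case False
      then show ?thesis unfolding W_def using degree_add_eq_left[of "- (S * U)" V] SU ne by simp
    qed
    moreover from this have "W \<noteq> 0" using pos by auto
    ultimately show False using le pos max by (auto simp: max_def split: if_splits)
  qed
  have "degree W < degree V"
  proof (cases "W = 0")
    case True
    then show ?thesis using pos dV by simp
  next
    case False
    then show ?thesis using le pos dV by (auto simp: max_def split: if_splits)
  qed
  moreover have "2 * V - S * U = V + W" by (simp add: W_def)
  ultimately show "degree (2 * V - S * U) = degree V" by (metis degree_add_eq_left)
qed

text \<open>
  The holomorphic area form of the surface \<open>s\<^sup>2 + u\<^sup>2 + v\<^sup>2 - s u v = D\<close> has only logarithmic poles at
  infinity.  Evaluated on the velocity of a polynomial curve going to infinity and a variation of the
  curve of no larger degree it is therefore a polynomial vanishing at infinity, that is, zero.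
\<close>

lemma markov_area_zero_max:
  fixes S U V :: "complex poly"
  assumes eq: "S\<^sup>2 + U\<^sup>2 + V\<^sup>2 - S * U * V = [:D:]" and D: "D \<noteq> 0" "D \<noteq> 4"
    and pos: "degree S > 0" "degree U > 0" and max: "degree S \<le> degree V" "degree U \<le> degree V"
    and var: "(2 * S - U * V) * S' + (2 * U - S * V) * U' + (2 * V - S * U) * V' = 0"
    and deg: "degree S' \<le> degree S" "degree U' \<le> degree U"
  shows "pderiv S * U' = S' * pderiv U \<and> pderiv U * V' = U' * pderiv V \<and> pderiv V * S' = V' * pderiv S"
proof -
  define X Y Z where XYZ: "X = 2 * S - U * V" "Y = 2 * U - S * V" "Z = 2 * V - S * U"
  \<comment> \<open>The cross product of velocity and variation. Both are orthogonal to the gradient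
    \<open>(X, Y, Z)\<close>, so the cross product is parallel to it.\<close>
  define cs cu cv where c: "cs = pderiv U * V' - U' * pderiv V" "cu = pderiv V * S' - V' * pderiv S"
    "cv = pderiv S * U' - S' * pderiv U"
  have "pderiv (S\<^sup>2 + U\<^sup>2 + V\<^sup>2 - S * U * V) = 0" unfolding eq by (simp add: pderiv_pCons)
  then have dot: "X * pderiv S + Y * pderiv U + Z * pderiv V = 0"
    by (simp add: XYZ pderiv_add pderiv_diff pderiv_mult power2_eq_square algebra_simps)
  have dot': "X * S' + Y * U' + Z * V' = 0" using var by (simp add: XYZ)
  have "Z * cs = X * cv + pderiv U * (X * S' + Y * U' + Z * V') - U' * (X * pderiv S + Y * pderiv U + Z * pderiv V)"
    by (simp add: c algebra_simps)
  then have Zcs: "Z * cs = X * cv" by (simp add: dot dot')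
  have "Z * cu = Y * cv + S' * (X * pderiv S + Y * pderiv U + Z * pderiv V) - pderiv S * (X * S' + Y * U' + Z * V')"
    by (simp add: c algebra_simps)
  then have Zcu: "Z * cu = Y * cv" by (simp add: dot dot')
  obtain e1 e2 e3 where bezout: "e1 * X + e2 * Y + e3 * Z = 4 * [:D:] * ([:D:] - 4)"
    using markov_gradient_bezout[OF eq] unfolding XYZ by metis
  have degZ: "degree Z = degree S + degree U" "Z \<noteq> 0"
    using markov_degree[OF eq pos max] pos by (auto simp: XYZ)
  have const: "4 * [:D:] * ([:D:] - 4) = [:4 * D * (D - 4):]" by (simp add: numeral_poly)
  \<comment> \<open>Smoothness enters here: a combination of the partial derivatives is a nonzero
    constant, so \<open>Z\<close> divides \<open>cv\<close>.\<close>
  have "Z * (e1 * cs + e2 * cu + e3 * cv) = cv * (e1 * X + e2 * Y + e3 * Z)"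
  proof -
    have "Z * (e1 * cs + e2 * cu + e3 * cv) = e1 * (Z * cs) + e2 * (Z * cu) + e3 * (Z * cv)"
      by (simp add: algebra_simps)
    then show ?thesis unfolding Zcs Zcu by (simp add: algebra_simps)
  qed
  then have "Z * (e1 * cs + e2 * cu + e3 * cv) = smult (4 * D * (D - 4)) cv"
    unfolding bezout const by simp
  then have "Z dvd smult (4 * D * (D - 4)) cv" by (metis dvd_triv_left)
  then have "Z dvd cv" using D by (simp add: dvd_smult_cancel)
  \<comment> \<open>Differentiation in \<open>t\<close> loses one degree, so \<open>cv\<close> stays
    below \<open>degree S + degree U\<close>, the degree of \<open>Z\<close>.\<close>
  moreover have "degree cv < degree Z"
  proof -
    have "degree (pderiv S * U') < degree Z" "degree (S' * pderiv U) < degree Z"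
      using degree_mult_le[of "pderiv S" U'] degree_mult_le[of S' "pderiv U"] pos deg
      by (simp_all add: degZ degree_pderiv)
    then show ?thesis unfolding c by (rule degree_diff_less)
  qed
  ultimately have "cv = 0" using divides_degree by force
  then show ?thesis using Zcs Zcu degZ(2) by (simp add: c)
qed

text \<open>A cyclic permutation of the three variables puts the largest degree in the last
  place.\<close>

lemma markov_area_zero:
  fixes S U V :: "complex poly"
  assumes eq: "S\<^sup>2 + U\<^sup>2 + V\<^sup>2 - S * U * V = [:D:]" and D: "D \<noteq> 0" "D \<noteq> 4"
    and pos: "degree S > 0" "degree U > 0" "degree V > 0"
    and var: "(2 * S - U * V) * S' + (2 * U - S * V) * U' + (2 * V - S * U) * V' = 0"
    and deg: "degree S' \<le> degree S" "degree U' \<le> degree U" "degree V' \<le> degree V"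
  shows "pderiv S * U' = S' * pderiv U \<and> pderiv U * V' = U' * pderiv V \<and> pderiv V * S' = V' * pderiv S"
proof -
  consider "degree S \<le> degree V" "degree U \<le> degree V" | "degree U \<le> degree S" "degree V \<le> degree S"
    | "degree V \<le> degree U" "degree S \<le> degree U" by linarith
  then show ?thesis
  proof cases
    case 1
    then show ?thesis using markov_area_zero_max[OF eq D pos(1,2) 1 var deg(1,2)] by simp
  next
    case 2
    have "U\<^sup>2 + V\<^sup>2 + S\<^sup>2 - U * V * S = [:D:]"
      "(2 * U - V * S) * U' + (2 * V - U * S) * V' + (2 * S - U * V) * S' = 0"
      using eq var by (simp_all add: algebra_simps)
    then show ?thesis using markov_area_zero_max[OF _ D pos(2,3) 2 _ deg(2,3)] by simp
  next
    case 3
    have "V\<^sup>2 + S\<^sup>2 + U\<^sup>2 - V * S * U = [:D:]"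
      "(2 * V - S * U) * V' + (2 * S - V * U) * S' + (2 * U - V * S) * U' = 0"
      using eq var by (simp_all add: algebra_simps)
    then show ?thesis using markov_area_zero_max[OF _ D pos(3,1) 3 _ deg(3,1)] by simp
  qed
qed

text \<open>For constant \<open>s\<close> the quadratic form in \<open>U\<close> and
  \<open>V\<close> splits into two linear forms, along the roots \<open>k\<close>, \<open>l\<close>
  of \<open>x^2 - s x + 1\<close>. Their product is the nonzero constant \<open>D - s^2\<close>, so
  each form is constant; \<open>s^2 \<noteq> 4\<close> makes them independent.\<close>

lemma markov_const:
  fixes S U V :: "complex poly"
  assumes eq: "S\<^sup>2 + U\<^sup>2 + V\<^sup>2 - S * U * V = [:D:]"
    and S: "S = [:s:]" "s\<^sup>2 \<noteq> 4" "s\<^sup>2 \<noteq> D"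
  shows "degree U = 0" "degree V = 0"
proof -
  define r where "r = csqrt (s\<^sup>2 - 4)"
  define k l where kl: "k = (s + r) / 2" "l = (s - r) / 2"
  have r2: "r * r = s * s - 4" using power2_csqrt[of "s\<^sup>2 - 4"] by (simp add: r_def power2_eq_square)
  have "r \<noteq> 0" using S(2) r2 by (auto simp: power2_eq_square)
  then have "k \<noteq> l" "k - l \<noteq> 0" by (auto simp: kl)
  have sum: "k + l = s" by (simp add: kl field_simps)
  have prod: "k * l = 1" using r2 by (simp add: kl field_simps)
  have "poly ((U - smult k V) * (U - smult l V)) t = poly [:D - s\<^sup>2:] t" for t
  proof -
    have e: "s\<^sup>2 + (poly U t)\<^sup>2 + (poly V t)\<^sup>2 - s * poly U t * poly V t = D"
      using arg_cong[OF eq, of "\<lambda>p. poly p t"] by (simp add: S(1) mult.assoc)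
    have "poly ((U - smult k V) * (U - smult l V)) t
       = (poly U t)\<^sup>2 + (k * l) * (poly V t)\<^sup>2 - (k + l) * poly U t * poly V t"
      by (simp add: algebra_simps power2_eq_square)
    also have "\<dots> = D - s\<^sup>2" unfolding sum prod using e by (simp add: algebra_simps)
    finally show ?thesis by simp
  qed
  then have "(U - smult k V) * (U - smult l V) = [:D - s\<^sup>2:]" by (rule poly_ext)
  then have "degree (U - smult k V) = 0" "degree (U - smult l V) = 0"
    using S(3) by (auto intro: degree_mult_const_eq_0)
  then obtain c d where cd: "U - smult k V = [:c:]" "U - smult l V = [:d:]"
    by (metis degree_eq_zeroE)
  have "smult (k - l) V = [:d - c:]"
    using arg_cong2[OF cd(2) cd(1), of "(-)"] by (simp add: smult_diff_left)
  then show "degree V = 0" using \<open>k - l \<noteq> 0\<close> by (metis degree_pCons_0 degree_smult_eq)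
  then obtain e where "V = [:e:]" by (metis degree_eq_zeroE)
  then have "U = [:c + k * e:]" using cd(1) by (simp add: algebra_simps)
  then show "degree U = 0" by simp
qed

section \<open>Rigidity of pairs with constant traces\<close>

text \<open>A polynomial map from the line to the torus \<open>x y = c\<close> is constant.\<close>

lemma poly_const_if_product_const:
  fixes p q :: "complex poly"
  assumes "\<And>t. poly p t * poly q t = c" "c \<noteq> 0"
  shows "poly p t = poly p 0" "poly q t = poly q 0"
proof -
  have "p * q = [:c:]" by (rule poly_ext) (simp add: assms(1))
  then have "degree p = 0" "degree q = 0" using assms(2) degree_mult_const_eq_0 by blast+
  then show "poly p t = poly p 0" "poly q t = poly q 0" by (auto elim!: degree_eq_zeroE)
qed

text \<open>Here \<open>g\<close> is the commutator, so \<open>g ** b\<close> has the trace of a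
  conjugate of \<open>b\<close>. For \<open>a\<close> and \<open>a ** b\<close>, Cayley-Hamilton
  removes the square that appears. Thus \<open>g\<close> and the traces of \<open>a\<close>,
  \<open>b\<close>, \<open>a ** b\<close> fix the traces of their products with
  \<open>g\<close>.\<close>

lemma commutator_traces:
  fixes a b g :: "complex^2^2"
  assumes "det a = 1" "det b = 1" "a ** b = g ** (b ** a)"
  shows "trace (g ** a) = trace a * (trace g - 1)" "trace (g ** b) = trace b"
    "trace (g ** (a ** b)) = trace (a ** b) * (trace g - 1)"
proof -
  have "a ** (mat (trace a) - a) = mat 1" "b ** (mat (trace b) - b) = mat 1"
    using assms(1,2) by (simp_all add: matrix_2_simps algebra_simps)
  then have cancel: "M ** a ** (mat (trace a) - a) = M" "M ** b ** (mat (trace b) - b) = M"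
    for M :: "complex^2^2"
    by (simp_all add: matrix_mul_assoc[symmetric])
  have g: "g = a ** b ** (mat (trace a) - a) ** (mat (trace b) - b)"
    unfolding assms(3) by (simp add: matrix_mul_assoc cancel)
  define a' b' where "a' = mat (trace a) - a" and "b' = mat (trace b) - b"
  have g: "g = a ** b ** a' ** b'" and cancel': "M ** a ** a' = M" "M ** b' ** b = M" for M :: "complex^2^2"
  proof -
    show "g = a ** b ** a' ** b'" using g by (simp add: a'_def b'_def)
    show "M ** a ** a' = M" using cancel(1) by (simp add: a'_def)
    have "b' ** b = mat 1" using assms(2) by (simp add: b'_def matrix_2_simps algebra_simps)
    then show "M ** b' ** b = M" by (simp add: matrix_mul_assoc[symmetric])
  qed
  have "a' ** a = mat 1" using assms(1) by (simp add: a'_def matrix_2_simps algebra_simps)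
  then show "trace (g ** b) = trace b"
    using trace_mul_sym[of "a ** b" a'] trace_mul_sym[of b "mat 1"]
    by (simp add: g cancel' matrix_mul_assoc)
  have tr_mat: "trace (mat c ** M - N) = c * trace M - trace N" "trace (mat c ** M) = c * trace M"
    for c and M N :: "complex^2^2"
    by (simp_all add: trace_2 algebra_simps)
  have "trace (g ** a) = trace (a ** a ** (b ** a' ** b'))"
    unfolding g trace_mul_sym[of _ a] by (simp add: matrix_mul_assoc)
  also have "a ** a ** (b ** a' ** b') = mat (trace a) ** g - b ** a' ** b'"
    unfolding cayley_hamilton_2[of a] assms(1) g
    by (simp add: vec_eq_iff forall_2 mult_2_component mat_component algebra_simps)
  also have "trace \<dots> = trace a * trace g - trace a"
  proof -
    have "trace (b ** (a' ** b')) = trace a'"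
      unfolding trace_mul_sym[of b] by (simp add: cancel')
    moreover have "trace a' = trace a" by (simp add: a'_def trace_2 mat_component)
    ultimately show ?thesis by (simp add: tr_mat matrix_mul_assoc)
  qed
  finally show "trace (g ** a) = trace a * (trace g - 1)" by (simp add: algebra_simps)
  define c where "c = a ** b"
  have "det c = 1" by (simp add: c_def det_mul assms(1,2))
  have gc: "g = c ** (a' ** b')" by (simp add: g c_def matrix_mul_assoc)
  have "trace (g ** c) = trace (c ** c ** (a' ** b'))"
    unfolding gc trace_mul_sym[of _ c] by (simp add: matrix_mul_assoc)
  also have "c ** c ** (a' ** b') = mat (trace c) ** g - a' ** b'"
    unfolding cayley_hamilton_2[of c] \<open>det c = 1\<close> gc
    by (simp add: vec_eq_iff forall_2 mult_2_component mat_component algebra_simps)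
  also have "trace \<dots> = trace c * trace g - trace c"
  proof -
    have "trace (a' ** b') = trace c"
      by (simp add: a'_def b'_def c_def trace_2 mult_2_component mat_component algebra_simps)
    then show ?thesis by (simp add: tr_mat)
  qed
  finally show "trace (g ** (a ** b)) = trace (a ** b) * (trace g - 1)"
    by (simp add: c_def algebra_simps)
qed

lemma linear_2_unique:
  fixes l m x y x' y' :: complex
  assumes "l \<noteq> m" "x + y = x' + y'" "l * x + m * y = l * x' + m * y'"
  shows "x = x'" "y = y'"
proof -
  have "(l - m) * (x - x') = (l * x + m * y - (l * x' + m * y')) - m * ((x + y) - (x' + y'))"
    by (simp add: algebra_simps)
  then have "(l - m) * (x - x') = 0" using assms(2,3) by simp
  then show "x = x'" using assms(1) by simp
  then show "y = y'" using assms(2) by simp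
qed

text \<open>For diagonal \<open>g\<close> with distinct entries, \<open>trace x\<close> and
  \<open>trace (g ** x)\<close> determine the diagonal of \<open>x\<close>. Applied to
  \<open>a\<close>, \<open>b\<close> and \<open>a ** b\<close>, this makes every product of an upper
  with a lower off-diagonal entry constant; a nonzero such product has constant factors.\<close>

lemma polynomial_pair_rigid_diag:
  fixes a b :: "complex \<Rightarrow> complex^2^2" and g :: "complex^2^2" and A B :: "2 \<Rightarrow> 2 \<Rightarrow> complex poly"
  assumes A: "\<And>t i j. a t $ i $ j = poly (A i j) t" and B: "\<And>t i j. b t $ i $ j = poly (B i j) t"
    and det: "\<And>t. det (a t) = 1" "\<And>t. det (b t) = 1"
    and comm: "\<And>t. a t ** b t = g ** (b t ** a t)"
    and diag: "g $ 1 $ 2 = 0" "g $ 2 $ 1 = 0" "g $ 1 $ 1 \<noteq> g $ 2 $ 2" "det g = 1"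
    and tr: "\<And>t. trace (a t) = trace (a 0)" "\<And>t. trace (b t) = trace (b 0)"
      "\<And>t. trace (a t ** b t) = trace (a 0 ** b 0)"
  shows "a t = a 0" "b t = b 0"
proof -
  have trg: "trace (g ** a t) = trace (g ** a 0)" "trace (g ** b t) = trace (g ** b 0)"
    "trace (g ** (a t ** b t)) = trace (g ** (a 0 ** b 0))" for t
    using commutator_traces[OF det comm] tr by simp_all
  have a_diag: "a t $ 1 $ 1 = a 0 $ 1 $ 1" "a t $ 2 $ 2 = a 0 $ 2 $ 2" for t
    using linear_2_unique[OF diag(3), of "a t $ 1 $ 1" "a t $ 2 $ 2" "a 0 $ 1 $ 1" "a 0 $ 2 $ 2"]
      tr(1)[of t] trg(1)[of t] diag(1,2) by (simp_all add: trace_2 mult_2_component)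
  have b_diag: "b t $ 1 $ 1 = b 0 $ 1 $ 1" "b t $ 2 $ 2 = b 0 $ 2 $ 2" for t
    using linear_2_unique[OF diag(3), of "b t $ 1 $ 1" "b t $ 2 $ 2" "b 0 $ 1 $ 1" "b 0 $ 2 $ 2"]
      tr(2)[of t] trg(2)[of t] diag(1,2) by (simp_all add: trace_2 mult_2_component)
  have aa: "a t $ 1 $ 2 * a t $ 2 $ 1 = a 0 $ 1 $ 2 * a 0 $ 2 $ 1" for t
    using det(1)[of t] det(1)[of 0] unfolding det_2 a_diag[of t] by algebra
  have bb: "b t $ 1 $ 2 * b t $ 2 $ 1 = b 0 $ 1 $ 2 * b 0 $ 2 $ 1" for t
    using det(2)[of t] det(2)[of 0] unfolding det_2 b_diag[of t] by algebra
  have ab: "a t $ 1 $ 2 * b t $ 2 $ 1 = a 0 $ 1 $ 2 * b 0 $ 2 $ 1"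
    "a t $ 2 $ 1 * b t $ 1 $ 2 = a 0 $ 2 $ 1 * b 0 $ 1 $ 2" for t
    using linear_2_unique[OF diag(3), of "a t $ 1 $ 2 * b t $ 2 $ 1" "a t $ 2 $ 1 * b t $ 1 $ 2"
        "a 0 $ 1 $ 2 * b 0 $ 2 $ 1" "a 0 $ 2 $ 1 * b 0 $ 1 $ 2"]
      tr(3)[of t] trg(3)[of t] diag(1,2)
    by (simp_all add: trace_2 mult_2_component a_diag[of t] b_diag[of t] algebra_simps)
  \<comment> \<open>If both upper or both lower entries vanished, the pair at time zero would be
    triangular. The entry \<open>g $ 1 $ 1\<close> of its commutator would then be \<open>1\<close>,
    against distinct eigenvalues with product \<open>1\<close>.\<close>
  have irr: "\<not> (a 0 $ 1 $ 2 = 0 \<and> b 0 $ 1 $ 2 = 0)" "\<not> (a 0 $ 2 $ 1 = 0 \<and> b 0 $ 2 $ 1 = 0)"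
  proof -
    have "False" if "a 0 $ 1 $ 2 * a 0 $ 2 $ 1 = 0" "b 0 $ 1 $ 2 * b 0 $ 2 $ 1 = 0"
      "a 0 $ 1 $ 2 * b 0 $ 2 $ 1 = 0" "b 0 $ 1 $ 2 * a 0 $ 2 $ 1 = 0"
    proof -
      have nz: "a 0 $ 1 $ 1 \<noteq> 0" "b 0 $ 1 $ 1 \<noteq> 0"
        using det(1)[of 0] det(2)[of 0] that(1,2) by (auto simp: det_2)
      have "(a 0 ** b 0) $ 1 $ 1 = (g ** (b 0 ** a 0)) $ 1 $ 1" by (simp only: comm)
      then have "a 0 $ 1 $ 1 * b 0 $ 1 $ 1 = g $ 1 $ 1 * (a 0 $ 1 $ 1 * b 0 $ 1 $ 1)"
        using that(3,4) diag(1) by (simp add: mult_2_component mult.commute)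
      then have "g $ 1 $ 1 = 1" using nz by simp
      then show False using diag by (simp add: det_2)
    qed
    then show "\<not> (a 0 $ 1 $ 2 = 0 \<and> b 0 $ 1 $ 2 = 0)" "\<not> (a 0 $ 2 $ 1 = 0 \<and> b 0 $ 2 $ 1 = 0)"
      by auto
  qed
  have const: "poly p t = poly p 0 \<and> poly q t = poly q 0"
    if "\<And>t. poly p t * poly q t = poly p 0 * poly q 0" "poly p 0 \<noteq> 0" "poly q 0 \<noteq> 0"
    for p q :: "complex poly" and t
  proof -
    have "poly p 0 * poly q 0 \<noteq> 0" using that(2,3) by simp
    from poly_const_if_product_const[OF that(1) this] show ?thesis by blast
  qed
  have prods: "poly (A 1 2) t * poly (A 2 1) t = poly (A 1 2) 0 * poly (A 2 1) 0"
    "poly (B 1 2) t * poly (B 2 1) t = poly (B 1 2) 0 * poly (B 2 1) 0"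
    "poly (A 1 2) t * poly (B 2 1) t = poly (A 1 2) 0 * poly (B 2 1) 0"
    "poly (B 1 2) t * poly (A 2 1) t = poly (B 1 2) 0 * poly (A 2 1) 0" for t
    using aa[of t] bb[of t] ab[of t] by (simp_all add: A B mult.commute)
  have off: "poly (A 1 2) t = poly (A 1 2) 0 \<and> poly (A 2 1) t = poly (A 2 1) 0
     \<and> poly (B 1 2) t = poly (B 1 2) 0 \<and> poly (B 2 1) t = poly (B 2 1) 0" for t
  proof -
    \<comment> \<open>\<open>p\<close> is an upper and \<open>q\<close> a lower entry, both nonzero
      at \<open>0\<close> and hence constant. The remaining upper entry \<open>p'\<close> is
      recovered from its product with \<open>q\<close>, the remaining lower entry \<open>q'\<close>
      from its product with \<open>p\<close>.\<close>
    have cases: "\<forall>t. poly p t = poly p 0" "\<forall>t. poly q t = poly q 0" "\<forall>t. poly p' t = poly p' 0" "\<forall>t. poly q' t = poly q' 0"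
      if pq: "\<And>t. poly p t * poly q t = poly p 0 * poly q 0"
        and p'q: "\<And>t. poly p' t * poly q t = poly p' 0 * poly q 0"
        and pq': "\<And>t. poly p t * poly q' t = poly p 0 * poly q' 0"
        and nz: "poly p 0 \<noteq> 0" "poly q 0 \<noteq> 0" for p q p' q' :: "complex poly"
    proof -
      show p: "\<forall>t. poly p t = poly p 0" and q: "\<forall>t. poly q t = poly q 0" using const[OF pq nz] by auto
      show "\<forall>t. poly p' t = poly p' 0" using p'q q nz(2) by (metis mult_cancel_right)
      show "\<forall>t. poly q' t = poly q' 0" using pq' p nz(1) by (metis mult_cancel_left)
    qed
    have "poly (A 1 2) 0 \<noteq> 0 \<or> poly (B 1 2) 0 \<noteq> 0" "poly (A 2 1) 0 \<noteq> 0 \<or> poly (B 2 1) 0 \<noteq> 0"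
      using irr by (auto simp: A B)
    then consider "poly (A 1 2) 0 \<noteq> 0" "poly (A 2 1) 0 \<noteq> 0" | "poly (A 1 2) 0 \<noteq> 0" "poly (B 2 1) 0 \<noteq> 0"
      | "poly (B 1 2) 0 \<noteq> 0" "poly (A 2 1) 0 \<noteq> 0" | "poly (B 1 2) 0 \<noteq> 0" "poly (B 2 1) 0 \<noteq> 0" by blast
    then show ?thesis
    proof cases
      case 1
      from cases[OF prods(1) prods(4) prods(3) 1] show ?thesis by blast
    next
      case 2
      from cases[OF prods(3) prods(2) prods(1) 2] show ?thesis by blast
    next
      case 3
      from cases[OF prods(4) prods(1) prods(2) 3] show ?thesis by blast
    next
      case 4
      from cases[OF prods(2) prods(3) prods(4) 4] show ?thesis by blast
    qed
  qed
  show "a t = a 0" "b t = b 0"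
    using a_diag[of t] b_diag[of t] off[of t] by (auto simp: vec_eq_iff forall_2 A B)
qed

text \<open>The characteristic polynomial has nonzero discriminant; the columns of \<open>h\<close>
  are eigenvectors for its two roots.\<close>

lemma diagonalizable_2:
  fixes g :: "complex^2^2"
  assumes "(trace g)\<^sup>2 \<noteq> 4 * det g"
  obtains h k :: "complex^2^2" where "h ** k = mat 1" "k ** h = mat 1"
    "(k ** g ** h) $ 1 $ 2 = 0" "(k ** g ** h) $ 2 $ 1 = 0" "(k ** g ** h) $ 1 $ 1 \<noteq> (k ** g ** h) $ 2 $ 2"
proof -
  define r where "r = csqrt ((trace g)\<^sup>2 - 4 * det g)"
  define l m where lm: "l = (trace g + r) / 2" "m = (trace g - r) / 2"
  have r2: "r * r = trace g * trace g - 4 * det g"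
    using power2_csqrt[of "(trace g)\<^sup>2 - 4 * det g"] by (simp add: r_def power2_eq_square)
  have "r \<noteq> 0" using assms r2 by (auto simp: power2_eq_square)
  then have ne: "l \<noteq> m" by (auto simp: lm)
  have sum: "l + m = trace g" by (simp add: lm field_simps)
  have prod: "l * m = det g" using r2 by (simp add: lm field_simps)
  have eigen: "\<exists>v. v \<noteq> 0 \<and> g *v v = c *s v" if "c * c - trace g * c + det g = 0" for c
  proof -
    have "det (g - mat c) = c * c - trace g * c + det g"
      by (simp add: det_2 trace_2 mat_component algebra_simps)
    then have "\<not> invertible (g - mat c)" using that by (simp add: invertible_det_nz)
    then obtain v where "v \<noteq> 0" "(g - mat c) *v v = 0"
      using matrix_left_invertible_ker[of "g - mat c"] unfolding invertible_left_inverse by blast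
    then have "v \<noteq> 0 \<and> g *v v = c *s v"
      by (simp add: vec_eq_iff forall_2 matrix_vector_mult_def sum_2 mat_component algebra_simps)
    then show ?thesis by blast
  qed
  obtain v where v: "v \<noteq> 0" "g *v v = l *s v"
    using eigen[of l] by (auto simp: sum[symmetric] prod[symmetric] algebra_simps)
  obtain w where w: "w \<noteq> 0" "g *v w = m *s w"
    using eigen[of m] by (auto simp: sum[symmetric] prod[symmetric] algebra_simps)
  define h :: "complex^2^2" where "h = (\<chi> i j. if j = 1 then v $ i else w $ i)"
  have h: "h $ i $ 1 = v $ i" "h $ i $ 2 = w $ i" for i by (simp_all add: h_def)
  have gv: "g $ i $ 1 * v $ 1 + g $ i $ 2 * v $ 2 = l * v $ i"
    "g $ i $ 1 * w $ 1 + g $ i $ 2 * w $ 2 = m * w $ i" for i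
    using arg_cong[OF v(2), of "\<lambda>x. x $ i"] arg_cong[OF w(2), of "\<lambda>x. x $ i"]
    by (simp_all add: matrix_vector_mult_def sum_2)
  have "det h \<noteq> 0"
  proof
    assume "det h = 0"
    then have d: "v $ 1 * w $ 2 = w $ 1 * v $ 2" by (simp add: det_2 h)
    have "(l - m) * (v $ i * w $ j) = 0" for i j
    proof -
      have comm: "v $ p * w $ q = v $ q * w $ p" for p q
        using d exhaust_2[of p] exhaust_2[of q] by (auto simp: mult.commute)
      have "l * v $ i * w $ j = (g $ i $ 1 * v $ 1 + g $ i $ 2 * v $ 2) * w $ j"
        by (simp add: gv)
      also have "\<dots> = (g $ i $ 1 * w $ 1 + g $ i $ 2 * w $ 2) * v $ j"
        unfolding distrib_right mult.assoc comm[of 1 j] comm[of 2 j] by (simp add: algebra_simps)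
      also have "\<dots> = m * v $ i * w $ j" using comm[of j i] by (simp only: gv) (simp add: mult.commute)
      finally show ?thesis by (simp add: algebra_simps)
    qed
    then have "v $ i = 0 \<or> w $ j = 0" for i j using ne by simp
    then show False using v(1) w(1) by (auto simp: vec_eq_iff)
  qed
  define k where "k = mat (1 / det h) ** (mat (trace h) - h)"
  have hk: "h ** k = mat 1" "k ** h = mat 1"
  proof -
    have adj: "h ** (mat (trace h) - h) = mat (det h)" "(mat (trace h) - h) ** h = mat (det h)"
      by (simp_all add: matrix_2_simps algebra_simps)
    have "h ** k = mat (1 / det h) ** (h ** (mat (trace h) - h))"
      unfolding k_def by (simp only: mat_mult_commute[of _ h] matrix_mul_assoc)
    then show "h ** k = mat 1" using \<open>det h \<noteq> 0\<close> by (simp add: adj(1) vec_eq_iff mat_component)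
    show "k ** h = mat 1" using \<open>det h \<noteq> 0\<close>
      by (simp add: k_def matrix_mul_assoc[symmetric] adj(2) vec_eq_iff mat_component)
  qed
  define e :: "complex^2^2" where "e = (\<chi> i j. if i = j then (if i = 1 then l else m) else 0)"
  have "g ** h = h ** e"
    by (simp add: vec_eq_iff forall_2 mult_2_component h gv) (simp add: e_def mult.commute)
  then have "k ** g ** h = e"
    by (simp add: matrix_mul_assoc[symmetric]) (simp add: matrix_mul_assoc hk)
  then show thesis
    using that[OF hk] ne by (simp add: e_def)
qed

text \<open>Reduction to diagonal \<open>g\<close>: conjugation by a constant matrix preserves
  traces, determinants and the commutator equation, and keeps the entries polynomial in
  \<open>t\<close>.\<close>

lemma polynomial_pair_rigid:
  fixes a b :: "complex \<Rightarrow> complex^2^2" and g :: "complex^2^2" and A B :: "2 \<Rightarrow> 2 \<Rightarrow> complex poly"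
  assumes A: "\<And>t i j. a t $ i $ j = poly (A i j) t" and B: "\<And>t i j. b t $ i $ j = poly (B i j) t"
    and det: "\<And>t. det (a t) = 1" "\<And>t. det (b t) = 1"
    and comm: "\<And>t. a t ** b t = g ** (b t ** a t)"
    and g: "det g = 1" "(trace g)\<^sup>2 \<noteq> 4"
    and tr: "\<And>t. trace (a t) = trace (a 0)" "\<And>t. trace (b t) = trace (b 0)"
      "\<And>t. trace (a t ** b t) = trace (a 0 ** b 0)"
  shows "a t = a 0" "b t = b 0"
proof -
  obtain h k :: "complex^2^2" where hk: "h ** k = mat 1" "k ** h = mat 1"
    and diag: "(k ** g ** h) $ 1 $ 2 = 0" "(k ** g ** h) $ 2 $ 1 = 0"
      "(k ** g ** h) $ 1 $ 1 \<noteq> (k ** g ** h) $ 2 $ 2"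
    using diagonalizable_2[of g] g by auto
  have cancel: "M ** h ** k = M" "M ** k ** h = M" for M :: "complex^2^2"
    by (simp_all add: matrix_mul_assoc[symmetric] hk)
  have dhk: "det k * det h = 1" using hk(2) by (metis det_I det_mul)
  have det_conj: "det (k ** x ** h) = det x" for x
    using dhk by (simp add: det_mul algebra_simps)
  have tr_conj: "trace (k ** x ** h) = trace x" for x
    by (metis cancel(1) hk(1) matrix_mul_assoc matrix_mul_rid trace_mul_sym)
  have mul_conj: "k ** x ** h ** (k ** y ** h) = k ** (x ** y) ** h" for x y
    by (simp add: matrix_mul_assoc cancel)
  define con where "con = (\<lambda>P i j. \<Sum>p\<in>UNIV. \<Sum>q\<in>UNIV. smult (k $ i $ p * h $ q $ j) (P p q :: complex poly))"
  have con: "(k ** x t ** h) $ i $ j = poly (con P i j) t" if "\<And>t i j. x t $ i $ j = poly (P i j) t"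
    for x P t i j
    by (simp add: con_def UNIV_2 sum_2 mult_2_component that algebra_simps)
  have unconj: "x = y" if "k ** x ** h = k ** y ** h" for x y
  proof -
    have "h ** (k ** x ** h) ** k = x" for x
      by (metis cancel(1) hk(1) matrix_mul_assoc matrix_mul_lid)
    then show ?thesis using that by metis
  qed
  have "k ** a t ** h = k ** a 0 ** h \<and> k ** b t ** h = k ** b 0 ** h"
  proof (intro conjI polynomial_pair_rigid_diag[where g = "k ** g ** h" and A = "con A" and B = "con B"
        and a = "\<lambda>t. k ** a t ** h" and b = "\<lambda>t. k ** b t ** h"])
  qed (use diag g(1) det comm tr in \<open>simp_all add: con A B det_conj tr_conj mul_conj\<close>)
  then show "a t = a 0" "b t = b 0" using unconj by blast+
qed

text \<open>Along the curve, \<open>P\<close> of the trace \<open>T\<close> is constant, so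
  \<open>n \<alpha>(T) T'\<close> vanishes. As \<open>a\<close> is not scalar,
  \<open>\<alpha>(T)\<close> is never zero; hence \<open>T\<close> is constant, and
  \<open>x t\<close> is recovered from \<open>a\<close> as
  \<open>(a - \<beta>) / \<alpha>\<close>.\<close>

lemma polynomial_root_rigid:
  fixes x :: "complex \<Rightarrow> complex^2^2" and A :: "2 \<Rightarrow> 2 \<Rightarrow> complex poly"
  assumes A: "\<And>t i j. x t $ i $ j = poly (A i j) t" and det: "\<And>t. det (x t) = 1"
    and pp: "SL2_power_polys n \<alpha> \<beta>" and n: "n \<noteq> 0"
    and power: "\<And>t. x t [^]\<^bsub>SL2\<^esub> n = a" and a: "\<And>c. a \<noteq> mat c"
  shows "x t = x 0"
proof -
  have pow: "a = mat (poly \<alpha> (trace (x t))) ** x t + mat (poly \<beta> (trace (x t)))" for t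
    using pp det[of t] power[of t] unfolding SL2_power_polys_def by metis
  have nz: "poly \<alpha> (trace (x t)) \<noteq> 0" for t
  proof
    assume "poly \<alpha> (trace (x t)) = 0"
    then have "a = mat (poly \<beta> (trace (x t)))"
      using pow[of t] by (simp add: vec_eq_iff)
    then show False using a by blast
  qed
  define P where "P = (\<lambda>\<tau>. \<tau> * poly \<alpha> \<tau> + 2 * poly \<beta> \<tau>)"
  define T where "T = A 1 1 + A 2 2"
  have T: "trace (x t) = poly T t" for t by (simp add: T_def trace_2 A)
  have const: "(\<lambda>t. P (poly T t)) = (\<lambda>_. trace a)"
  proof
    fix t
    show "P (poly T t) = trace a"
      using arg_cong[OF pow[of t], of trace] by (simp add: P_def T[symmetric] trace_2 mat_component algebra_simps)
  qed
  have "poly (pderiv T) t = 0" for t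
  proof -
    have "(P has_field_derivative of_int n * poly \<alpha> (poly T t)) (at (poly T t))"
      using pp unfolding SL2_power_polys_def P_def by blast
    then have "((\<lambda>t. P (poly T t)) has_field_derivative of_int n * poly \<alpha> (poly T t) * poly (pderiv T) t) (at t)"
      using DERIV_chain2[OF _ poly_DERIV] by blast
    moreover have "((\<lambda>t. P (poly T t)) has_field_derivative 0) (at t)" unfolding const by simp
    ultimately have "of_int n * poly \<alpha> (poly T t) * poly (pderiv T) t = 0" by (rule DERIV_unique)
    then show ?thesis using n nz[of t] by (simp add: T)
  qed
  then have "pderiv T = 0" by (intro poly_ext) simp
  then have "degree T = 0" by (simp add: pderiv_eq_0_iff)
  then have "poly T t = poly T 0" by (auto elim!: degree_eq_zeroE)
  then have tr: "trace (x t) = trace (x 0)" by (simp add: T)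
  have "mat (poly \<alpha> (trace (x 0))) ** x t = mat (poly \<alpha> (trace (x 0))) ** x 0"
    using pow[of t] pow[of 0] unfolding tr by (metis add_right_cancel)
  then show ?thesis using nz[of 0] by (simp add: vec_eq_iff)
qed

section \<open>Generic points of the fibre\<close>

lemma matrix_pair_coords_continuous: "k \<in> matrix_pair_coords \<Longrightarrow> continuous_on UNIV k"
  by (auto simp: matrix_pair_coords_def case_prod_beta intro!: continuous_intros)

lemma polynomial_functions_entries [intro]:
  "(\<lambda>p. fst p $ i $ j) \<in> polynomial_functions matrix_pair_coords"
  "(\<lambda>p. snd p $ i $ j) \<in> polynomial_functions matrix_pair_coords"
  by (rule polynomial_functions.coord, force simp: matrix_pair_coords_def case_prod_beta)+

lemma matrix_pair_tendsto:
  fixes \<gamma> :: "'b \<Rightarrow> (complex^2^2) \<times> (complex^2^2)"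
  assumes "\<And>f. f \<in> polynomial_functions matrix_pair_coords \<Longrightarrow> ((\<lambda>z. f (\<gamma> z)) \<longlongrightarrow> f p) F"
  shows "(\<gamma> \<longlongrightarrow> p) F"
proof -
  have "((\<lambda>z. fst (\<gamma> z)) \<longlongrightarrow> fst p) F" "((\<lambda>z. snd (\<gamma> z)) \<longlongrightarrow> snd p) F"
    by (intro vec_tendstoI assms[where f = "\<lambda>p. fst p $ _ $ _"] assms[where f = "\<lambda>p. snd p $ _ $ _"]
        polynomial_functions_entries)+
  from tendsto_Pair[OF this] show ?thesis by simp
qed

lemma DERIV_nonzero_eventually_ne:
  fixes f :: "complex \<Rightarrow> complex"
  assumes "(f has_field_derivative d) (at a)" "d \<noteq> 0"
  shows "\<forall>\<^sub>F z in at a. f z \<noteq> c"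
proof (cases "f a = c")
  case True
  have "((\<lambda>z. (f z - f a) / (z - a)) \<longlongrightarrow> d) (at a)"
    using assms(1) by (simp add: has_field_derivative_iff)
  from tendsto_imp_eventually_ne[OF this assms(2)] show ?thesis
    by eventually_elim (auto simp: True)
next
  case False
  have "(f \<longlongrightarrow> f a) (at a)" using DERIV_isCont[OF assms(1)] by (simp add: isCont_def)
  from tendsto_imp_eventually_ne[OF this False] show ?thesis .
qed

section \<open>The fibre and its trace functions\<close>

locale commutator_fiber =
  fixes n m :: int and g :: "complex^2^2" and \<alpha> \<beta> \<alpha>' \<beta>' :: "complex poly"
  assumes n: "n \<noteq> 0" and m: "m \<noteq> 0" and det_g: "det g = 1" and trace_g: "trace g \<noteq> 2" "trace g \<noteq> - 2"
    and powers_n: "SL2_power_polys n \<alpha> \<beta>" and powers_m: "SL2_power_polys m \<alpha>' \<beta>'"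
begin

abbreviation "X \<equiv> word_fiber n m g"
abbreviation "PF \<equiv> polynomial_functions matrix_pair_coords"

text \<open>A formula in the entries instead of a power in \<open>SL2\<close>: it is polynomial on
  all pairs of matrices and agrees with the power in determinant \<open>1\<close>. The same holds
  for \<open>B\<close>.\<close>

definition A where "A p = mat (poly \<alpha> (trace (fst p))) ** fst p + mat (poly \<beta> (trace (fst p)))"
  for p :: "(complex^2^2) \<times> (complex^2^2)"
definition B where "B p = mat (poly \<alpha>' (trace (snd p))) ** snd p + mat (poly \<beta>' (trace (snd p)))"
  for p :: "(complex^2^2) \<times> (complex^2^2)"
definition s where "s p = trace (A p)"
definition u where "u p = trace (B p)"
definition v where "v p = trace (A p ** B p)"
definition "D = trace g + 2"
text \<open>\<open>Qs\<close>, \<open>Qu\<close> and \<open>Qv\<close> are the partial derivatives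
  of \<open>s^2 + u^2 + v^2 - s u v\<close>. Up to sign they are also the speeds of the traces under
  the twists.\<close>

definition Qs where "Qs p = 2 * s p - u p * v p"
definition Qu where "Qu p = 2 * u p - s p * v p"
definition Qv where "Qv p = 2 * v p - s p * u p"

lemma A_eq: "det (fst p) = 1 \<Longrightarrow> A p = fst p [^]\<^bsub>SL2\<^esub> n"
  using powers_n unfolding SL2_power_polys_def A_def by simp

lemma B_eq: "det (snd p) = 1 \<Longrightarrow> B p = snd p [^]\<^bsub>SL2\<^esub> m"
  using powers_m unfolding SL2_power_polys_def B_def by simp

lemma det_A: "det (fst p) = 1 \<Longrightarrow> det (A p) = 1"
  by (simp add: A_eq SL2_power_det)

lemma det_B: "det (snd p) = 1 \<Longrightarrow> det (B p) = 1"
  by (simp add: B_eq SL2_power_det)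

lemma mem_X: "p \<in> X \<longleftrightarrow> det (fst p) = 1 \<and> det (snd p) = 1 \<and> A p ** B p = g ** (B p ** A p)"
  by (cases p) (simp add: word_fiber_def SL2_carrier word_eq_iff A_eq B_eq cong: conj_cong)

lemma PF_A: "(\<lambda>p. A p $ i $ j) \<in> PF"
  unfolding A_def vector_add_component mat_mult_component mat_component trace_2
  by (cases "i = j")
     (auto intro!: polynomial_functions_add polynomial_functions_mult polynomial_functions_poly)

lemma PF_B: "(\<lambda>p. B p $ i $ j) \<in> PF"
  unfolding B_def vector_add_component mat_mult_component mat_component trace_2
  by (cases "i = j")
     (auto intro!: polynomial_functions_add polynomial_functions_mult polynomial_functions_poly)

lemma PF_s: "s \<in> PF" and PF_u: "u \<in> PF" and PF_v: "v \<in> PF"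
  unfolding s_def[abs_def] u_def[abs_def] v_def[abs_def] trace_2 mult_2_component
  by (intro polynomial_functions_add polynomial_functions_mult PF_A PF_B)+

lemma PF_Q: "Qu \<in> PF" "Qv \<in> PF"
  unfolding Qu_def[abs_def] Qv_def[abs_def]
  by (intro polynomial_functions_diff polynomial_functions_mult PF_s PF_u PF_v polynomial_functions_const)+

lemma D: "D \<noteq> 0" "D \<noteq> 4"
  using trace_g by (auto simp: D_def add_eq_0_iff2)

lemma markov: "p \<in> X \<Longrightarrow> (s p)\<^sup>2 + (u p)\<^sup>2 + (v p)\<^sup>2 - s p * u p * v p = D"
  unfolding s_def u_def v_def D_def by (rule trace_commutator_2) (auto simp: mem_X det_A det_B)

lemma gradient_nonzero: "p \<in> X \<Longrightarrow> Qs p \<noteq> 0 \<or> Qu p \<noteq> 0 \<or> Qv p \<noteq> 0"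
  using markov_gradient_bezout[OF markov, of p] D unfolding Qs_def Qu_def Qv_def by auto

text \<open>Commuting powers would have commutator \<open>mat 1\<close>, whose trace is
  \<open>2\<close>.\<close>

lemma commute_False:
  assumes p: "p \<in> X" and comm: "A p ** B p = B p ** A p"
  shows False
proof -
  have "det (B p ** A p) \<noteq> 0" using p by (simp add: mem_X det_A det_B det_mul)
  then obtain C where C: "(B p ** A p) ** C = mat 1"
    using invertible_det_nz invertible_right_inverse by blast
  have "g ** (B p ** A p) = B p ** A p" using p comm by (simp add: mem_X)
  then have "g ** ((B p ** A p) ** C) = (B p ** A p) ** C" by (simp only: matrix_mul_assoc)
  then have "g = mat 1" by (simp add: C)
  then show False using trace_g by (simp add: trace_2 mat_component)
qed

lemma A_not_scalar: "p \<in> X \<Longrightarrow> A p \<noteq> mat c"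
  using commute_False[of p] mat_mult_commute[of c "B p"] by auto

lemma B_not_scalar: "p \<in> X \<Longrightarrow> B p \<noteq> mat c"
  using commute_False[of p] mat_mult_commute[of c "A p"] by auto

text \<open>A zero of \<open>\<alpha>\<close> would make the power scalar. With its counterpart for
  \<open>\<alpha>'\<close>, this permits lifting roots at every point of the fibre.\<close>

lemma \<alpha>_nonzero: "p \<in> X \<Longrightarrow> poly \<alpha> (trace (fst p)) \<noteq> 0"
  using A_not_scalar[of p "poly \<beta> (trace (fst p))"] by (auto simp: A_def vec_eq_iff)

lemma \<alpha>'_nonzero: "p \<in> X \<Longrightarrow> poly \<alpha>' (trace (snd p)) \<noteq> 0"
  using B_not_scalar[of p "poly \<beta>' (trace (snd p))"] by (auto simp: B_def vec_eq_iff)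

text \<open>A tangent direction of the fibre, given by a curve. Differentiability is demanded after
  composition with every polynomial function, so it applies to the traces and to the coefficients of
  \<open>C f\<close> alike.\<close>

definition curve_at where
  "curve_at \<gamma> p \<longleftrightarrow> \<gamma> 0 = p \<and> (\<forall>\<^sub>F z in nhds 0. \<gamma> z \<in> X) \<and>
     (\<forall>f\<in>PF. (\<lambda>z. f (\<gamma> z)) field_differentiable at (0::complex))"

lemma curve_atI:
  assumes "\<gamma> 0 = p" "\<forall>\<^sub>F z in nhds 0. \<gamma> z \<in> X"
    "\<And>i j. (\<lambda>z. fst (\<gamma> z) $ i $ j) field_differentiable at 0"
    "\<And>i j. (\<lambda>z. snd (\<gamma> z) $ i $ j) field_differentiable at 0"
  shows "curve_at \<gamma> p"
  unfolding curve_at_def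
proof (intro conjI ballI assms(1,2))
  fix f assume "f \<in> PF"
  then show "(\<lambda>z. f (\<gamma> z)) field_differentiable at 0"
    by (rule polynomial_functions_differentiable)
       (use assms(3,4) in \<open>auto simp: matrix_pair_coords_def case_prod_beta\<close>)
qed

lemma curve_tendsto:
  assumes "curve_at \<gamma> p"
  shows "(\<gamma> \<longlongrightarrow> p) (nhds 0)"
proof (rule matrix_pair_tendsto)
  fix f assume "f \<in> PF"
  then have "isCont (\<lambda>z. f (\<gamma> z)) 0"
    using assms field_differentiable_imp_continuous_at unfolding curve_at_def by blast
  then have "((\<lambda>z. f (\<gamma> z)) \<longlongrightarrow> f (\<gamma> 0)) (nhds 0)"
    using tendsto_at_iff_tendsto_nhds[of "\<lambda>z. f (\<gamma> z)" 0] by (simp add: isCont_def)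
  then show "((\<lambda>z. f (\<gamma> z)) \<longlongrightarrow> f p) (nhds 0)"
    using assms by (simp add: curve_at_def)
qed

text \<open>The twist of \<open>B p\<close> by \<open>c z\<close> is lifted to the second matrix by
  \<open>SL2_root_lift\<close>. Multiplying the fibre equation by \<open>c z\<close> on the right
  and moving \<open>c z\<close> past \<open>A p\<close> shows that the curve stays in the
  fibre.\<close>

lemma twist_b:
  assumes p: "p \<in> X"
  obtains \<gamma> where "curve_at \<gamma> p"
    "((\<lambda>z. s (\<gamma> z)) has_field_derivative 0) (at 0)"
    "((\<lambda>z. u (\<gamma> z)) has_field_derivative Qv p) (at 0)"
    "((\<lambda>z. v (\<gamma> z)) has_field_derivative - Qu p) (at 0)"
proof -
  have X: "det (fst p) = 1" "det (snd p) = 1" "A p ** B p = g ** (B p ** A p)"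
    using p by (simp_all add: mem_X)
  obtain c where c: "c 0 = mat 1" "\<forall>\<^sub>F z in nhds 0. det (c z) = 1" "\<And>z. A p ** c z = c z ** A p"
    "\<And>(M :: complex^2^2) i j. (\<lambda>z. (M ** c z) $ i $ j) field_differentiable at 0"
    "((\<lambda>z. trace (B p ** c z)) has_field_derivative 2 * trace (A p ** B p) - trace (A p) * trace (B p)) (at 0)"
    "((\<lambda>z. trace (A p ** (B p ** c z))) has_field_derivative trace (A p) * trace (A p ** B p) - 2 * trace (B p)) (at 0)"
    by (rule twist_curve[OF det_A[OF X(1)], of "B p"]) (rule that; assumption)
  have det: "\<forall>\<^sub>F z in nhds 0. det (B p ** c z) = 1"
    using c(2) by eventually_elim (simp add: det_mul det_B X)
  obtain Y where Y: "Y 0 = snd p" "\<forall>\<^sub>F z in nhds 0. det (Y z) = 1 \<and> Y z [^]\<^bsub>SL2\<^esub> m = B p ** c z"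
    "\<And>i j. (\<lambda>z. Y z $ i $ j) field_differentiable at 0"
    by (rule SL2_root_lift[OF powers_m m X(2) \<alpha>'_nonzero[OF p], of "\<lambda>z. B p ** c z"])
       (use det c(1,4) B_eq[OF X(2)] in auto)
  define \<gamma> where "\<gamma> = (\<lambda>z. (fst p, Y z))"
  have A\<gamma>: "A (\<gamma> z) = A p" for z by (simp add: A_def \<gamma>_def)
  have ev: "\<forall>\<^sub>F z in nhds 0. det (Y z) = 1 \<and> B (\<gamma> z) = B p ** c z"
    using Y(2) by eventually_elim (simp add: B_eq \<gamma>_def)
  show thesis
  proof (rule that[of \<gamma>])
    show "curve_at \<gamma> p"
    proof (rule curve_atI)
      show "\<forall>\<^sub>F z in nhds 0. \<gamma> z \<in> X"
        using ev
      proof eventually_elim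
        case (elim z)
        have "A p ** (B p ** c z) = g ** (B p ** (A p ** c z))"
          by (simp add: matrix_mul_assoc X(3))
        then have "A p ** (B p ** c z) = g ** (B p ** c z ** A p)"
          by (simp add: c(3) matrix_mul_assoc)
        then show ?case using elim X(1) by (simp add: mem_X A\<gamma>) (simp add: \<gamma>_def)
      qed
    qed (use Y in \<open>simp_all add: \<gamma>_def\<close>)
    show "((\<lambda>z. s (\<gamma> z)) has_field_derivative 0) (at 0)" by (simp add: s_def A\<gamma>)
    have "\<forall>\<^sub>F z in nhds 0. u (\<gamma> z) = trace (B p ** c z)"
      using ev by eventually_elim (simp add: u_def)
    from DERIV_cong_ev[OF refl this refl]
    show "((\<lambda>z. u (\<gamma> z)) has_field_derivative Qv p) (at 0)"
      using c(5) by (simp add: Qv_def s_def u_def v_def)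
    have "\<forall>\<^sub>F z in nhds 0. v (\<gamma> z) = trace (A p ** (B p ** c z))"
      using ev by eventually_elim (simp add: v_def A\<gamma>)
    from DERIV_cong_ev[OF refl this refl]
    show "((\<lambda>z. v (\<gamma> z)) has_field_derivative - Qu p) (at 0)"
      using c(6) by (simp add: Qu_def s_def u_def v_def)
  qed
qed

text \<open>The mirror image of \<open>twist_b\<close>: \<open>c z\<close> now commutes with
  \<open>B p\<close>, and cyclicity of the trace matches \<open>trace (B p ** A p)\<close> with
  \<open>v p\<close>.\<close>

lemma twist_a:
  assumes p: "p \<in> X"
  obtains \<gamma> where "curve_at \<gamma> p"
    "((\<lambda>z. s (\<gamma> z)) has_field_derivative Qv p) (at 0)"
    "((\<lambda>z. u (\<gamma> z)) has_field_derivative 0) (at 0)"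
    "((\<lambda>z. v (\<gamma> z)) has_field_derivative - Qs p) (at 0)"
proof -
  have X: "det (fst p) = 1" "det (snd p) = 1" "A p ** B p = g ** (B p ** A p)"
    using p by (simp_all add: mem_X)
  obtain c where c: "c 0 = mat 1" "\<forall>\<^sub>F z in nhds 0. det (c z) = 1" "\<And>z. B p ** c z = c z ** B p"
    "\<And>(M :: complex^2^2) i j. (\<lambda>z. (M ** c z) $ i $ j) field_differentiable at 0"
    "((\<lambda>z. trace (A p ** c z)) has_field_derivative 2 * trace (B p ** A p) - trace (B p) * trace (A p)) (at 0)"
    "((\<lambda>z. trace (B p ** (A p ** c z))) has_field_derivative trace (B p) * trace (B p ** A p) - 2 * trace (A p)) (at 0)"
    by (rule twist_curve[OF det_B[OF X(2)], of "A p"]) (rule that; assumption)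
  have det: "\<forall>\<^sub>F z in nhds 0. det (A p ** c z) = 1"
    using c(2) by eventually_elim (simp add: det_mul det_A X)
  obtain Y where Y: "Y 0 = fst p" "\<forall>\<^sub>F z in nhds 0. det (Y z) = 1 \<and> Y z [^]\<^bsub>SL2\<^esub> n = A p ** c z"
    "\<And>i j. (\<lambda>z. Y z $ i $ j) field_differentiable at 0"
    by (rule SL2_root_lift[OF powers_n n X(1) \<alpha>_nonzero[OF p], of "\<lambda>z. A p ** c z"])
       (use det c(1,4) A_eq[OF X(1)] in auto)
  define \<gamma> where "\<gamma> = (\<lambda>z. (Y z, snd p))"
  have B\<gamma>: "B (\<gamma> z) = B p" for z by (simp add: B_def \<gamma>_def)
  have ev: "\<forall>\<^sub>F z in nhds 0. det (Y z) = 1 \<and> A (\<gamma> z) = A p ** c z"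
    using Y(2) by eventually_elim (simp add: A_eq \<gamma>_def)
  show thesis
  proof (rule that[of \<gamma>])
    show "curve_at \<gamma> p"
    proof (rule curve_atI)
      show "\<forall>\<^sub>F z in nhds 0. \<gamma> z \<in> X"
        using ev
      proof eventually_elim
        case (elim z)
        have "A p ** (B p ** c z) = g ** (B p ** (A p ** c z))"
          by (simp add: matrix_mul_assoc X(3))
        then have "A p ** c z ** B p = g ** (B p ** (A p ** c z))"
          by (simp add: c(3) matrix_mul_assoc)
        then show ?case using elim X(2) by (simp add: mem_X B\<gamma>) (simp add: \<gamma>_def)
      qed
    qed (use Y in \<open>simp_all add: \<gamma>_def\<close>)
    show "((\<lambda>z. u (\<gamma> z)) has_field_derivative 0) (at 0)" by (simp add: u_def B\<gamma>)
    have "\<forall>\<^sub>F z in nhds 0. s (\<gamma> z) = trace (A p ** c z)"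
      using ev by eventually_elim (simp add: s_def)
    from DERIV_cong_ev[OF refl this refl]
    show "((\<lambda>z. s (\<gamma> z)) has_field_derivative Qv p) (at 0)"
      using c(5) by (simp add: Qv_def s_def u_def v_def trace_mul_sym[of "B p"] mult.commute)
    have "\<forall>\<^sub>F z in nhds 0. v (\<gamma> z) = trace (B p ** (A p ** c z))"
      using ev by eventually_elim (simp add: v_def B\<gamma> trace_mul_sym[of "B p"])
    from DERIV_cong_ev[OF refl this refl]
    show "((\<lambda>z. v (\<gamma> z)) has_field_derivative - Qs p) (at 0)"
      using c(6) by (simp add: Qs_def s_def u_def v_def trace_mul_sym[of "B p"])
  qed
qed

section \<open>Density of generic points in the fibre\<close>

lemma open_avoid:
  assumes "f \<in> PF" "finite F"
  shows "open {q. f q \<notin> F}"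
proof -
  have "continuous_on UNIV f"
    by (rule polynomial_functions_continuous[OF assms(1) matrix_pair_coords_continuous])
  then have "open (f -` (- F))"
    using assms(2) by (intro open_vimage) (auto simp: open_Compl finite_imp_closed)
  moreover have "f -` (- F) = {q. f q \<notin> F}" by auto
  ultimately show ?thesis by simp
qed

text \<open>One refinement step: a curve along which \<open>f\<close> has nonzero derivative reaches
  nearby fibre points with values outside \<open>F\<close>, and continuity keeps the values outside
  \<open>F\<close> on an open set.\<close>

lemma move:
  assumes W: "open W" "p \<in> X \<inter> W" and F: "finite F" and f: "f \<in> PF"
    and curve: "f p \<notin> F \<or> (\<exists>\<gamma> d. curve_at \<gamma> p \<and> ((\<lambda>z. f (\<gamma> z)) has_field_derivative d) (at 0) \<and> d \<noteq> 0)"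
  obtains W' q where "open W'" "W' \<subseteq> W" "q \<in> X \<inter> W'" "\<And>q. q \<in> W' \<Longrightarrow> f q \<notin> F"
proof -
  have "\<exists>q\<in>X \<inter> W. f q \<notin> F"
  proof (cases "f p \<notin> F")
    case True
    then show ?thesis using W(2) by blast
  next
    case False
    then obtain \<gamma> d where \<gamma>: "curve_at \<gamma> p" and d: "((\<lambda>z. f (\<gamma> z)) has_field_derivative d) (at 0)" "d \<noteq> 0"
      using curve by blast
    have "\<forall>\<^sub>F z in at 0. \<gamma> z \<in> X"
      using \<gamma> by (auto simp: curve_at_def eventually_at_filter elim: eventually_mono)
    moreover have "\<forall>\<^sub>F z in nhds 0. \<gamma> z \<in> W"
      using topological_tendstoD[OF curve_tendsto[OF \<gamma>] W(1)] W(2) by blast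
    then have "\<forall>\<^sub>F z in at 0. \<gamma> z \<in> W"
      by (auto simp: eventually_at_filter elim: eventually_mono)
    moreover have "\<forall>\<^sub>F z in at 0. \<forall>c\<in>F. f (\<gamma> z) \<noteq> c"
      using F DERIV_nonzero_eventually_ne[OF d] by (intro eventually_ball_finite) auto
    ultimately have "\<forall>\<^sub>F z in at 0. \<gamma> z \<in> X \<inter> W \<and> f (\<gamma> z) \<notin> F"
      by eventually_elim auto
    then have "\<exists>z. \<gamma> z \<in> X \<inter> W \<and> f (\<gamma> z) \<notin> F"
      by (rule eventually_happens'[rotated]) simp
    then show ?thesis by blast
  qed
  then obtain q where "q \<in> X \<inter> W" "f q \<notin> F" by blast
  then show thesis
    by (intro that[of "W \<inter> {q. f q \<notin> F}" q] open_Int[OF W(1) open_avoid[OF f F]]) auto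
qed

text \<open>The order matters: once \<open>Qv\<close> and then \<open>Qu\<close> are nonzero, the
  twists move each of \<open>u\<close>, \<open>v\<close> and \<open>s\<close> with nonzero speed, so
  each can leave \<open>F\<close>.\<close>

lemma generic:
  assumes W: "open W" "p \<in> X \<inter> W" and F: "finite F"
  obtains W' q where "open W'" "W' \<subseteq> W" "q \<in> X \<inter> W'"
    "\<And>q. q \<in> W' \<Longrightarrow> Qv q \<noteq> 0 \<and> s q \<notin> F \<and> u q \<notin> F \<and> v q \<notin> F"
proof -
  note intros = derivative_eq_intros
  \<comment> \<open>Where \<open>Qv\<close> vanishes, smoothness leaves \<open>Qu\<close> or
    \<open>Qs\<close> nonzero. The matching twist fixes \<open>s\<close> and \<open>u\<close> to
    first order but moves \<open>v\<close>, and with it \<open>Qv\<close>.\<close>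
  have "Qv p \<notin> {0} \<or> (\<exists>\<gamma> d. curve_at \<gamma> p \<and> ((\<lambda>z. Qv (\<gamma> z)) has_field_derivative d) (at 0) \<and> d \<noteq> 0)"
  proof (cases "Qv p = 0")
    case True
    show ?thesis
    proof (cases "Qu p = 0")
      case False
      obtain \<gamma> where \<gamma>: "curve_at \<gamma> p" "((\<lambda>z. s (\<gamma> z)) has_field_derivative 0) (at 0)"
        "((\<lambda>z. u (\<gamma> z)) has_field_derivative Qv p) (at 0)" "((\<lambda>z. v (\<gamma> z)) has_field_derivative - Qu p) (at 0)"
        using twist_b W(2) by blast
      have "((\<lambda>z. Qv (\<gamma> z)) has_field_derivative - 2 * Qu p) (at 0)"
        unfolding Qv_def by (rule intros \<gamma>(2-4) refl)+ (simp add: True)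
      then show ?thesis using False \<gamma>(1) by (metis mult_eq_0_iff neg_equal_0_iff_equal zero_neq_numeral)
    next
      case Qu: True
      then have "Qs p \<noteq> 0" using gradient_nonzero True W(2) by blast
      obtain \<gamma> where \<gamma>: "curve_at \<gamma> p" "((\<lambda>z. s (\<gamma> z)) has_field_derivative Qv p) (at 0)"
        "((\<lambda>z. u (\<gamma> z)) has_field_derivative 0) (at 0)" "((\<lambda>z. v (\<gamma> z)) has_field_derivative - Qs p) (at 0)"
        using twist_a W(2) by blast
      have "((\<lambda>z. Qv (\<gamma> z)) has_field_derivative - 2 * Qs p) (at 0)"
        unfolding Qv_def by (rule intros \<gamma>(2-4) refl)+ (simp add: True)
      then show ?thesis using \<open>Qs p \<noteq> 0\<close> \<gamma>(1) by (metis mult_eq_0_iff neg_equal_0_iff_equal zero_neq_numeral)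
    qed
  qed simp
  from move[OF W _ PF_Q(2) this] obtain W1 p1 where 1: "open W1" "W1 \<subseteq> W" "p1 \<in> X \<inter> W1"
    "\<And>q. q \<in> W1 \<Longrightarrow> Qv q \<noteq> 0" by auto
  \<comment> \<open>Where \<open>Qu\<close> vanishes, the twist of \<open>b\<close> moves only
    \<open>u\<close> to first order, so \<open>Qu\<close> has derivative
    \<open>2 * Qv p1\<close>.\<close>
  have "Qu p1 \<notin> {0} \<or> (\<exists>\<gamma> d. curve_at \<gamma> p1 \<and> ((\<lambda>z. Qu (\<gamma> z)) has_field_derivative d) (at 0) \<and> d \<noteq> 0)"
  proof (cases "Qu p1 = 0")
    case True
    obtain \<gamma> where \<gamma>: "curve_at \<gamma> p1" "((\<lambda>z. s (\<gamma> z)) has_field_derivative 0) (at 0)"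
      "((\<lambda>z. u (\<gamma> z)) has_field_derivative Qv p1) (at 0)" "((\<lambda>z. v (\<gamma> z)) has_field_derivative - Qu p1) (at 0)"
      using twist_b 1(3) by blast
    have "((\<lambda>z. Qu (\<gamma> z)) has_field_derivative 2 * Qv p1) (at 0)"
      unfolding Qu_def by (rule intros \<gamma>(2-4) refl)+ (simp add: True)
    then show ?thesis using 1(3,4) \<gamma>(1) by (metis IntD2 mult_eq_0_iff zero_neq_numeral)
  qed simp
  from move[OF 1(1,3) _ PF_Q(1) this] obtain W2 p2 where 2: "open W2" "W2 \<subseteq> W1" "p2 \<in> X \<inter> W2"
    "\<And>q. q \<in> W2 \<Longrightarrow> Qu q \<noteq> 0" by auto
  have Qv: "Qv q \<noteq> 0" and Qu: "Qu q \<noteq> 0" if "q \<in> W2" for q using that 1(4) 2(2,4) by blast+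
  have step: "\<exists>\<gamma> d. curve_at \<gamma> q \<and> ((\<lambda>z. f (\<gamma> z)) has_field_derivative d) (at 0) \<and> d \<noteq> 0"
    if "q \<in> X" "q \<in> W2" "f \<in> {s, u, v}" for q f
  proof -
    obtain \<gamma> where \<gamma>: "curve_at \<gamma> q" "((\<lambda>z. s (\<gamma> z)) has_field_derivative Qv q) (at 0)"
      using twist_a \<open>q \<in> X\<close> by blast
    obtain \<gamma>' where \<gamma>': "curve_at \<gamma>' q" "((\<lambda>z. u (\<gamma>' z)) has_field_derivative Qv q) (at 0)"
      "((\<lambda>z. v (\<gamma>' z)) has_field_derivative - Qu q) (at 0)"
      using twist_b \<open>q \<in> X\<close> by blast
    have "- Qu q \<noteq> 0" using Qu[OF \<open>q \<in> W2\<close>] by simp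
    then show ?thesis using \<gamma> \<gamma>' Qv[OF \<open>q \<in> W2\<close>] \<open>f \<in> {s, u, v}\<close> by blast
  qed
  obtain W4 p4 where 4: "open W4" "W4 \<subseteq> W2" "p4 \<in> X \<inter> W4" "\<And>q. q \<in> W4 \<Longrightarrow> u q \<notin> F"
    using move[OF 2(1,3) F PF_u] step[of p2 u] 2(3) by blast
  have "p4 \<in> X" "p4 \<in> W2" using 4 by blast+
  then obtain W5 p5 where 5: "open W5" "W5 \<subseteq> W4" "p5 \<in> X \<inter> W5" "\<And>q. q \<in> W5 \<Longrightarrow> v q \<notin> F"
    using move[OF 4(1,3) F PF_v] step[of p4 v] by blast
  have "p5 \<in> X" "p5 \<in> W2" using 4 5 by blast+
  then obtain W6 p6 where 6: "open W6" "W6 \<subseteq> W5" "p6 \<in> X \<inter> W6" "\<And>q. q \<in> W6 \<Longrightarrow> s q \<notin> F"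
    using move[OF 5(1,3) F PF_s] step[of p5 s] by blast
  show thesis
  proof (rule that[OF 6(1) _ 6(3)])
    show "W6 \<subseteq> W" using 1(2) 2(2) 4(2) 5(2) 6(2) by blast
    show "Qv q \<noteq> 0 \<and> s q \<notin> F \<and> u q \<notin> F \<and> v q \<notin> F" if "q \<in> W6" for q
    proof -
      have "q \<in> W5" "q \<in> W4" "q \<in> W2" using that 4(2) 5(2) 6(2) by blast+
      then show ?thesis using that Qv 4(4) 5(4) 6(4) by simp
    qed
  qed
qed

end

section \<open>Triviality of polynomial flows\<close>

lemma eventually_zero_poly:
  fixes p :: "complex poly"
  assumes "\<forall>\<^sub>F t in nhds 0. poly p t = 0"
  shows "p = 0"
proof (rule ccontr)
  assume "p \<noteq> 0"
  then have "finite {t. poly p t = 0}" by (rule poly_roots_finite)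
  then have "open (- ({t. poly p t = 0} - {0}))"
    by (intro open_Compl finite_imp_closed) simp
  then have "\<forall>\<^sub>F t in nhds 0. t \<in> - ({t. poly p t = 0} - {0})"
    by (rule eventually_nhds_in_open) simp
  with assms have "\<forall>\<^sub>F t in nhds (0::complex). t = 0" by eventually_elim auto
  then have "\<forall>\<^sub>F t in at (0::complex). False" by (auto simp: eventually_at_filter elim: eventually_mono)
  then show False by simp
qed

lemma polynomial_family_eval:
  assumes "polynomial_family K c"
  shows "(\<lambda>p. poly (c p) t) \<in> polynomial_functions K"
proof -
  obtain N where N: "\<And>p. degree (c p) \<le> N" using assms unfolding polynomial_family_def by blast
  have "(\<lambda>p. poly (c p) t) = (\<lambda>p. \<Sum>i\<le>N. coeff (c p) i * t ^ i)"
  proof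
    fix p
    show "poly (c p) t = (\<Sum>i\<le>N. coeff (c p) i * t ^ i)"
      unfolding poly_altdef by (intro sum.mono_neutral_left) (use N in \<open>auto simp: coeff_eq_0\<close>)
  qed
  moreover have "\<dots> \<in> polynomial_functions K"
    using assms unfolding polynomial_family_def
    by (intro polynomial_functions_sum polynomial_functions_mult) auto
  ultimately show ?thesis by simp
qed

section \<open>Polynomial flows on the fibre\<close>

locale commutator_fiber_flow = commutator_fiber n m g \<alpha> \<beta> \<alpha>' \<beta>'
  + polynomial_flow matrix_pair_coords "word_fiber n m g" \<Phi> C
  for n m g \<alpha> \<beta> \<alpha>' \<beta>' \<Phi> C
begin

lemma C_0: "f \<in> PF \<Longrightarrow> p \<in> X \<Longrightarrow> poly (C f p) 0 = f p"
  using flow_poly[of f p 0] flow_0[of p] by simp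

lemma PF_coeff: "f \<in> PF \<Longrightarrow> (\<lambda>p. coeff (C f p) k) \<in> PF"
  using flow_family unfolding polynomial_family_def by blast

lemma markov_C:
  assumes "p \<in> X"
  shows "(C s p)\<^sup>2 + (C u p)\<^sup>2 + (C v p)\<^sup>2 - C s p * C u p * C v p = [:D:]"
  using markov[OF flow_in[OF assms]] assms PF_s PF_u PF_v
  by (intro poly_ext) (simp add: flow_poly)

text \<open>Since the degree is \<open>d\<close> throughout \<open>X \<inter> W\<close>, the orbit
  polynomial is a sum of \<open>d + 1\<close> terms with coefficients differentiable in
  \<open>z\<close>. Differentiating these bounds the degree of the variation.\<close>

lemma variation:
  assumes \<gamma>: "curve_at \<gamma> q" and q: "q \<in> W" and W: "open W" and f: "f \<in> PF"
    and deg: "\<And>p. p \<in> X \<Longrightarrow> p \<in> W \<Longrightarrow> degree (C f p) = d"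
  obtains f' where "degree f' \<le> d" "\<And>t. ((\<lambda>z. f (\<Phi> t (\<gamma> z))) has_field_derivative poly f' t) (at 0)"
proof -
  have inX: "\<forall>\<^sub>F z in nhds 0. \<gamma> z \<in> X \<and> \<gamma> z \<in> W"
    using \<gamma> topological_tendstoD[OF curve_tendsto[OF \<gamma>] W q]
    by (auto simp: curve_at_def eventually_conj_iff)
  define f' where "f' = (\<Sum>k\<le>d. monom (deriv (\<lambda>z. coeff (C f (\<gamma> z)) k) 0) k)"
  have der: "((\<lambda>z. coeff (C f (\<gamma> z)) k) has_field_derivative deriv (\<lambda>z. coeff (C f (\<gamma> z)) k) 0) (at 0)" for k
    using \<gamma> PF_coeff[OF f, of k] unfolding curve_at_def by (auto simp: field_differentiable_derivI)
  show thesis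
  proof (rule that[of f'])
    show "degree f' \<le> d"
      unfolding f'_def by (intro degree_sum_le) (auto intro: order_trans[OF degree_monom_le])
    fix t
    have der_sum: "((\<lambda>z. \<Sum>k\<le>d. coeff (C f (\<gamma> z)) k * t ^ k) has_field_derivative poly f' t) (at 0)"
      unfolding f'_def poly_sum poly_monom by (intro DERIV_sum DERIV_cmult_right der)
    have "\<forall>\<^sub>F z in nhds 0. f (\<Phi> t (\<gamma> z)) = (\<Sum>k\<le>d. coeff (C f (\<gamma> z)) k * t ^ k)"
      using inX by eventually_elim (use deg f in \<open>simp add: flow_poly poly_altdef\<close>)
    from DERIV_cong_ev[OF refl this refl] der_sum show "((\<lambda>z. f (\<Phi> t (\<gamma> z))) has_field_derivative poly f' t) (at 0)" by simp
  qed
qed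

text \<open>The coefficients at \<open>1\<close> are the velocity of the traces at \<open>q\<close>.
  The vanishing area of \<open>markov_area_zero\<close>, read at time zero, makes this velocity
  parallel to \<open>(s', u', v')\<close>.\<close>

lemma area_zero_along_curve:
  assumes \<gamma>: "curve_at \<gamma> q" and q: "q \<in> X" "q \<in> W" and W: "open W"
    and deg: "\<And>p. p \<in> X \<Longrightarrow> p \<in> W \<Longrightarrow> degree (C s p) = degree (C s q) \<and>
        degree (C u p) = degree (C u q) \<and> degree (C v p) = degree (C v q)"
    and pos: "degree (C s q) > 0" "degree (C u q) > 0" "degree (C v q) > 0"
    and der: "((\<lambda>z. s (\<gamma> z)) has_field_derivative s') (at 0)"
      "((\<lambda>z. u (\<gamma> z)) has_field_derivative u') (at 0)" "((\<lambda>z. v (\<gamma> z)) has_field_derivative v') (at 0)"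
  shows "coeff (C s q) 1 * u' = s' * coeff (C u q) 1" "coeff (C u q) 1 * v' = u' * coeff (C v q) 1"
    "coeff (C v q) 1 * s' = v' * coeff (C s q) 1"
proof -
  obtain S' where S': "degree S' \<le> degree (C s q)"
    "\<And>t. ((\<lambda>z. s (\<Phi> t (\<gamma> z))) has_field_derivative poly S' t) (at 0)"
    using variation[OF \<gamma> q(2) W PF_s, of "degree (C s q)"] deg by blast
  obtain U' where U': "degree U' \<le> degree (C u q)"
    "\<And>t. ((\<lambda>z. u (\<Phi> t (\<gamma> z))) has_field_derivative poly U' t) (at 0)"
    using variation[OF \<gamma> q(2) W PF_u, of "degree (C u q)"] deg by blast
  obtain V' where V': "degree V' \<le> degree (C v q)"
    "\<And>t. ((\<lambda>z. v (\<Phi> t (\<gamma> z))) has_field_derivative poly V' t) (at 0)"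
    using variation[OF \<gamma> q(2) W PF_v, of "degree (C v q)"] deg by blast
  have \<gamma>0: "\<gamma> 0 = q" and \<gamma>X: "\<forall>\<^sub>F z in nhds 0. \<gamma> z \<in> X" using \<gamma> by (auto simp: curve_at_def)
  \<comment> \<open>The variation is tangent to the trace surface:
    \<open>\<Phi> t (\<gamma> z)\<close> stays in the fibre for \<open>z\<close> near
    \<open>0\<close>, so the \<open>z\<close>-derivative of the surface equation vanishes.\<close>
  have "(2 * C s q - C u q * C v q) * S' + (2 * C u q - C s q * C v q) * U' + (2 * C v q - C s q * C u q) * V' = 0"
  proof (rule poly_ext)
    fix t
    define a b c where abc: "a = s (\<Phi> t q)" "b = u (\<Phi> t q)" "c = v (\<Phi> t q)"
    define h where "h z = (s (\<Phi> t (\<gamma> z)))\<^sup>2 + (u (\<Phi> t (\<gamma> z)))\<^sup>2 + (v (\<Phi> t (\<gamma> z)))\<^sup>2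
        - s (\<Phi> t (\<gamma> z)) * u (\<Phi> t (\<gamma> z)) * v (\<Phi> t (\<gamma> z))" for z
    have "(h has_field_derivative
        ((2 * a - b * c) * poly S' t + (2 * b - a * c) * poly U' t + (2 * c - a * b) * poly V' t)) (at 0)"
      unfolding h_def[abs_def]
      by (rule derivative_eq_intros S'(2) U'(2) V'(2) refl)+ (simp add: \<gamma>0 abc algebra_simps)
    moreover have "\<forall>\<^sub>F z in nhds 0. h z = D"
      using \<gamma>X by eventually_elim (simp add: h_def markov flow_in)
    from DERIV_cong_ev[OF refl this refl] have "(h has_field_derivative 0) (at 0)" by simp
    ultimately have "(2 * a - b * c) * poly S' t + (2 * b - a * c) * poly U' t + (2 * c - a * b) * poly V' t = 0"
      by (rule DERIV_unique)
    then show "poly ((2 * C s q - C u q * C v q) * S' + (2 * C u q - C s q * C v q) * U'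
        + (2 * C v q - C s q * C u q) * V') t = poly 0 t"
      using q(1) by (simp add: abc flow_poly PF_s PF_u PF_v)
  qed
  from markov_area_zero[OF markov_C[OF q(1)] D pos this S'(1) U'(1) V'(1)]
  have area: "pderiv (C s q) * U' = S' * pderiv (C u q)" "pderiv (C u q) * V' = U' * pderiv (C v q)"
    "pderiv (C v q) * S' = V' * pderiv (C s q)" by blast+
  have at_0: "d = poly f' 0"
    if "\<And>t. ((\<lambda>z. f (\<Phi> t (\<gamma> z))) has_field_derivative poly f' t) (at 0)"
      and "((\<lambda>z. f (\<gamma> z)) has_field_derivative d) (at 0)" for f f' d
  proof -
    have "\<forall>\<^sub>F z in nhds 0. f (\<Phi> 0 (\<gamma> z)) = f (\<gamma> z)" using \<gamma>X by eventually_elim (simp add: flow_0)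
    from DERIV_cong_ev[OF refl this refl] that(1)[of 0]
    have "((\<lambda>z. f (\<gamma> z)) has_field_derivative poly f' 0) (at 0)" by simp
    from DERIV_unique[OF that(2) this] show ?thesis .
  qed
  have p0: "poly (pderiv p) 0 = coeff p 1" for p :: "complex poly"
    by (simp add: poly_0_coeff_0 coeff_pderiv)
  show "coeff (C s q) 1 * u' = s' * coeff (C u q) 1" "coeff (C u q) 1 * v' = u' * coeff (C v q) 1"
    "coeff (C v q) 1 * s' = v' * coeff (C s q) 1"
    using arg_cong[OF area(1), of "\<lambda>p. poly p 0"] arg_cong[OF area(2), of "\<lambda>p. poly p 0"]
      arg_cong[OF area(3), of "\<lambda>p. poly p 0"]
    unfolding at_0[OF S'(2) der(1)] at_0[OF U'(2) der(2)] at_0[OF V'(2) der(3)]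
    by (simp_all add: p0)
qed

lemma flow_tendsto:
  assumes "q \<in> X"
  shows "((\<lambda>t. \<Phi> t q) \<longlongrightarrow> q) (nhds 0)"
proof (rule matrix_pair_tendsto)
  fix f assume f: "f \<in> PF"
  have "isCont (\<lambda>t. poly (C f q) t) 0" by simp
  then have "((\<lambda>t. poly (C f q) t) \<longlongrightarrow> poly (C f q) 0) (nhds 0)"
    using tendsto_at_iff_tendsto_nhds[of "poly (C f q)" 0] by (simp only: isCont_def)
  then show "((\<lambda>t. f (\<Phi> t q)) \<longlongrightarrow> f q) (nhds 0)"
    using f assms by (simp add: flow_poly C_0)
qed

text \<open>Rigidity is used twice: for the pair of powers, then for each matrix as a root of its
  constant, nonscalar power.\<close>

lemma fixed_if_traces_fixed:
  assumes q: "q \<in> X" and tr: "\<And>t. s (\<Phi> t q) = s q" "\<And>t. u (\<Phi> t q) = u q" "\<And>t. v (\<Phi> t q) = v q"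
  shows "\<Phi> t q = q"
proof -
  have X: "det (fst (\<Phi> t q)) = 1" "det (snd (\<Phi> t q)) = 1"
    "A (\<Phi> t q) ** B (\<Phi> t q) = g ** (B (\<Phi> t q) ** A (\<Phi> t q))" for t
    using flow_in[OF q, of t] by (simp_all add: mem_X)
  have "(trace g)\<^sup>2 \<noteq> 4" using trace_g power2_eq_iff[of "trace g" 2] by simp
  note rigid = polynomial_pair_rigid[where a = "\<lambda>t. A (\<Phi> t q)" and b = "\<lambda>t. B (\<Phi> t q)" and g = g
      and A = "\<lambda>i j. C (\<lambda>p. A p $ i $ j) q" and B = "\<lambda>i j. C (\<lambda>p. B p $ i $ j) q",
      OF flow_poly[OF PF_A q] flow_poly[OF PF_B q] det_A[OF X(1)] det_B[OF X(2)] X(3) det_g this]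
  have AB: "A (\<Phi> t q) = A q" "B (\<Phi> t q) = B q" for t
    using rigid tr unfolding s_def u_def v_def flow_0[OF q] by blast+
  have "fst (\<Phi> t q) = fst (\<Phi> 0 q)"
    by (rule polynomial_root_rigid[where A = "\<lambda>i j. C (\<lambda>p. fst p $ i $ j) q",
          OF flow_poly[OF polynomial_functions_entries(1) q] X(1) powers_n n _ A_not_scalar[OF q]])
       (simp add: A_eq[symmetric] X AB)
  moreover have "snd (\<Phi> t q) = snd (\<Phi> 0 q)"
    by (rule polynomial_root_rigid[where A = "\<lambda>i j. C (\<lambda>p. snd p $ i $ j) q",
          OF flow_poly[OF polynomial_functions_entries(2) q] X(2) powers_m m _ B_not_scalar[OF q]])
       (simp add: B_eq[symmetric] X AB)
  ultimately show ?thesis by (simp add: flow_0[OF q] prod_eq_iff)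
qed

lemma fixed_points_dense:
  assumes W: "open W" "p \<in> X" "p \<in> W"
  shows "\<exists>q \<in> X \<inter> W. \<forall>t. \<Phi> t q = q"
proof -
  define r where "r = csqrt D"
  have r: "r\<^sup>2 = D" by (simp add: r_def)
  \<comment> \<open>\<open>0\<close> is excluded so that the orbit polynomials are nonzero; the
    square roots of \<open>4\<close> and of \<open>D\<close> are the exceptional values in
    \<open>markov_const\<close>.\<close>
  define F where "F = {0, 2, - 2, r, - r}"
  have F: "x \<noteq> 0" "x\<^sup>2 \<noteq> 4" "x\<^sup>2 \<noteq> D" if "x \<notin> F" for x
    using that power2_eq_iff[of x 2] power2_eq_iff[of x r] by (auto simp: F_def r)
  have "finite F" by (simp add: F_def)
  then obtain W1 p1 where W1: "open W1" "W1 \<subseteq> W" "p1 \<in> X \<inter> W1"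
    and gen: "\<And>q. q \<in> W1 \<Longrightarrow> Qv q \<noteq> 0 \<and> s q \<notin> F \<and> u q \<notin> F \<and> v q \<notin> F"
    using generic[OF W(1), of p F] W(2,3) by (metis IntI)
  define d where "d p = degree (C s p) + degree (C u p) + degree (C v p)" for p
  have "\<exists>N. \<forall>p. d p \<le> N"
  proof -
    have "\<exists>N. \<forall>p. degree (C f p) \<le> N" if "f \<in> PF" for f
      using flow_family[OF that] by (simp add: polynomial_family_def)
    then obtain N1 N2 N3 where "\<And>p. degree (C s p) \<le> N1" "\<And>p. degree (C u p) \<le> N2" "\<And>p. degree (C v p) \<le> N3"
      using PF_s PF_u PF_v by metis
    then have "\<forall>p. d p \<le> N1 + N2 + N3" unfolding d_def by (simp add: add_mono)
    then show ?thesis by blast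
  qed
  then obtain N where "\<forall>p. p \<in> X \<inter> W1 \<longrightarrow> d p < Suc N" by (auto simp: less_Suc_eq_le)
  \<comment> \<open>A point of maximal total degree. On \<open>W2\<close> the coefficients at the
    degrees of \<open>p0\<close> stay nonzero, so no degree drops; maximality of the sum then
    forbids any to grow.\<close>
  then obtain p0 where p0: "p0 \<in> X \<inter> W1" and max: "\<And>p. p \<in> X \<inter> W1 \<Longrightarrow> d p \<le> d p0"
    using ex_has_greatest_nat[of "\<lambda>p. p \<in> X \<inter> W1", OF W1(3)] by blast
  define W2 where "W2 = W1 \<inter> {q. coeff (C s q) (degree (C s p0)) \<notin> {0}}
    \<inter> {q. coeff (C u q) (degree (C u p0)) \<notin> {0}} \<inter> {q. coeff (C v q) (degree (C v p0)) \<notin> {0}}"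
  have open_W2: "open W2" unfolding W2_def
    by (intro open_Int W1(1) open_avoid PF_coeff PF_s PF_u PF_v) simp_all
  have "C s p0 \<noteq> 0" "C u p0 \<noteq> 0" "C v p0 \<noteq> 0"
    using C_0[OF PF_s, of p0] C_0[OF PF_u, of p0] C_0[OF PF_v, of p0] p0 gen[of p0] F(1) by auto
  then have p0_W2: "p0 \<in> X" "p0 \<in> W2" using p0 by (auto simp: W2_def)
  have deg: "degree (C s q) = degree (C s p0) \<and> degree (C u q) = degree (C u p0) \<and> degree (C v q) = degree (C v p0)"
    if "q \<in> X" "q \<in> W2" for q
  proof -
    have "degree (C s p0) \<le> degree (C s q)" "degree (C u p0) \<le> degree (C u q)" "degree (C v p0) \<le> degree (C v q)"
      using that(2) by (auto simp: W2_def intro: le_degree)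
    moreover have "d q \<le> d p0" using max that by (simp add: W2_def)
    ultimately show ?thesis unfolding d_def by linarith
  qed
  have velocity: "coeff (C s q) 1 = 0 \<and> coeff (C u q) 1 = 0 \<and> coeff (C v q) 1 = 0"
    if q: "q \<in> X" "q \<in> W2" for q
  proof -
    have q1: "q \<in> W1" using q(2) by (simp add: W2_def)
    have const: "C f q = [:f q:]" if "degree (C f q) = 0" "f \<in> PF" for f
      using that(1) C_0[OF that(2) q(1)] by (auto elim!: degree_eq_zeroE)
    note eq = markov_C[OF q(1)]
    have eqs: "(C u q)\<^sup>2 + (C s q)\<^sup>2 + (C v q)\<^sup>2 - C u q * C s q * C v q = [:D:]"
      "(C v q)\<^sup>2 + (C s q)\<^sup>2 + (C u q)\<^sup>2 - C v q * C s q * C u q = [:D:]"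
      using eq by (simp_all add: algebra_simps)
    have zero: "coeff (C f q) 1 = 0" if "degree (C f q) = 0" for f
      using that by (intro coeff_eq_0) simp
    consider "degree (C s q) = 0" | "degree (C u q) = 0" | "degree (C v q) = 0"
      | "degree (C s q) > 0" "degree (C u q) > 0" "degree (C v q) > 0" by blast
    then show ?thesis
    proof cases
      case 1
      from markov_const[OF eq const[OF 1 PF_s]] F[of "s q"] gen[OF q1]
      show ?thesis by (simp add: 1 zero del: One_nat_def)
    next
      case 2
      from markov_const[OF eqs(1) const[OF 2 PF_u]] F[of "u q"] gen[OF q1]
      show ?thesis by (simp add: 2 zero del: One_nat_def)
    next
      case 3
      from markov_const[OF eqs(2) const[OF 3 PF_v]] F[of "v q"] gen[OF q1]
      show ?thesis by (simp add: 3 zero del: One_nat_def)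
    next
      case 4
      have deg': "degree (C s p) = degree (C s q) \<and> degree (C u p) = degree (C u q) \<and> degree (C v p) = degree (C v q)"
        if "p \<in> X" "p \<in> W2" for p using deg[OF that] deg[OF q] by simp
      have Qv: "Qv q \<noteq> 0" using gen[OF q1] by blast
      obtain \<gamma> where \<gamma>: "curve_at \<gamma> q" "((\<lambda>z. s (\<gamma> z)) has_field_derivative 0) (at 0)"
        "((\<lambda>z. u (\<gamma> z)) has_field_derivative Qv q) (at 0)" "((\<lambda>z. v (\<gamma> z)) has_field_derivative - Qu q) (at 0)"
        using twist_b q(1) by blast
      \<comment> \<open>This twist fixes \<open>s\<close> and moves \<open>u\<close> at speed
        \<open>Qv q\<close>, so a parallel velocity has zero \<open>s\<close>-component.\<close>
      have s0: "coeff (C s q) 1 = 0"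
        using area_zero_along_curve(1)[OF \<gamma>(1) q open_W2 deg' 4 \<gamma>(2-4)] Qv by (simp del: One_nat_def)
      obtain \<delta> where \<delta>: "curve_at \<delta> q" "((\<lambda>z. s (\<delta> z)) has_field_derivative Qv q) (at 0)"
        "((\<lambda>z. u (\<delta> z)) has_field_derivative 0) (at 0)" "((\<lambda>z. v (\<delta> z)) has_field_derivative - Qs q) (at 0)"
        using twist_a q(1) by blast
      \<comment> \<open>The second twist moves \<open>s\<close> at speed \<open>Qv q\<close> and
        fixes \<open>u\<close>; with \<open>s0\<close>, the two relations remove the other
        components.\<close>
      show ?thesis
        using area_zero_along_curve(1,3)[OF \<delta>(1) q open_W2 deg' 4 \<delta>(2-4)] Qv s0 by (simp del: One_nat_def)
    qed
  qed
  have const: "f (\<Phi> t p0) = f p0" if f: "f \<in> {s, u, v}" for f t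
  proof -
    have PF: "f \<in> PF" using f PF_s PF_u PF_v by blast
    \<comment> \<open>The orbit of \<open>p0\<close> remains in \<open>W2\<close> for small times,
      where the velocity is zero. A polynomial vanishing near \<open>0\<close> vanishes identically,
      which gives constancy for all times.\<close>
    have "\<forall>\<^sub>F t in nhds 0. \<Phi> t p0 \<in> W2"
      using topological_tendstoD[OF flow_tendsto[OF p0_W2(1)] open_W2 p0_W2(2)] .
    then have "\<forall>\<^sub>F t in nhds 0. poly (pderiv (C f p0)) t = 0"
      by eventually_elim (use velocity[OF flow_in[OF p0_W2(1)]] f flow_deriv[OF PF p0_W2(1)] in auto)
    then have "pderiv (C f p0) = 0" by (rule eventually_zero_poly)
    then have "degree (C f p0) = 0" by (simp add: pderiv_eq_0_iff)
    then have "poly (C f p0) t = poly (C f p0) 0" by (auto elim!: degree_eq_zeroE)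
    then show ?thesis using PF p0_W2(1) by (simp add: flow_poly C_0)
  qed
  have "\<Phi> t p0 = p0" for t
    by (rule fixed_if_traces_fixed[OF p0_W2(1)]) (simp_all add: const)
  then show ?thesis using p0 W1(2) by blast
qed

theorem flow_trivial:
  assumes p: "p \<in> X"
  shows "\<Phi> t p = p"
proof -
  have eq: "f (\<Phi> t p) = f p" if f: "f \<in> PF" for f
  proof (rule ccontr)
    assume "f (\<Phi> t p) \<noteq> f p"
    \<comment> \<open>With \<open>C f q\<close> in place of \<open>f (\<Phi> t q)\<close>, the
      function \<open>h\<close> is polynomial on the whole ambient space. Its nonvanishing set is
      open and must therefore contain a fixed point of the fibre.\<close>
    define h where "h q = poly (C f q) t - f q" for q
    have "h \<in> PF"
      unfolding h_def[abs_def] by (intro polynomial_functions_diff polynomial_family_eval flow_family f)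
    then have "open {q. h q \<notin> {0}}" by (rule open_avoid) simp
    moreover have "p \<in> {q. h q \<notin> {0}}"
      using \<open>f (\<Phi> t p) \<noteq> f p\<close> p f by (simp add: h_def flow_poly)
    ultimately obtain q where "q \<in> X" "h q \<noteq> 0" "\<Phi> t q = q"
      using fixed_points_dense p by fastforce
    then show False using f by (simp add: h_def flow_poly[symmetric])
  qed
  have "fst (\<Phi> t p) = fst p" "snd (\<Phi> t p) = snd p"
    using eq[OF polynomial_functions_entries(1)] eq[OF polynomial_functions_entries(2)]
    by (simp_all add: vec_eq_iff)
  then show ?thesis by (simp add: prod_eq_iff)
qed

end

section \<open>Locally nilpotent derivations\<close>

locale nilpotent_derivation =
  fixes K :: "('p \<Rightarrow> complex) set" and X :: "'p set" and d :: "('p \<Rightarrow> complex) \<Rightarrow> ('p \<Rightarrow> complex)"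
  assumes d: "d \<in> LND (regular_functions K X)"
begin

abbreviation "R \<equiv> regular_functions K X"

definition restr :: "('p \<Rightarrow> complex) \<Rightarrow> 'p \<Rightarrow> complex" where
  "restr f = (\<lambda>x. if x \<in> X then f x else 0)"

lemma R_iff: "a \<in> R \<longleftrightarrow> (\<exists>f\<in>polynomial_functions K. a = restr f)"
  by (auto simp: regular_functions_def restr_def)

lemma restr_add: "restr (f + h) = restr f + restr h"
  and restr_mult: "restr (f * h) = restr f * restr h"
  and restr_const: "restr (\<lambda>_. c) = (\<lambda>_. c) * restr 1"
  by (auto simp: restr_def fun_eq_iff plus_fun_def times_fun_def one_fun_def)

lemma R_restr: "f \<in> polynomial_functions K \<Longrightarrow> restr f \<in> R"
  by (auto simp: R_iff)

lemma R_one: "restr 1 \<in> R"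
  unfolding one_fun_def by (intro R_restr polynomial_functions.const)

lemma R_add: "a \<in> R \<Longrightarrow> b \<in> R \<Longrightarrow> a + b \<in> R"
  unfolding R_iff by (metis restr_add polynomial_functions.add)

lemma R_mult: "a \<in> R \<Longrightarrow> b \<in> R \<Longrightarrow> a * b \<in> R"
  unfolding R_iff by (metis restr_mult polynomial_functions.mult)

lemma R_outside: "a \<in> R \<Longrightarrow> x \<notin> X \<Longrightarrow> a x = 0"
  by (auto simp: R_iff restr_def)

lemma d_in: "a \<in> R \<Longrightarrow> d a \<in> R"
  and d_add: "a \<in> R \<Longrightarrow> b \<in> R \<Longrightarrow> d (a + b) = d a + d b"
  and d_scale: "a \<in> R \<Longrightarrow> d ((\<lambda>_. c) * a) = (\<lambda>_. c) * d a"
  and d_mult: "a \<in> R \<Longrightarrow> b \<in> R \<Longrightarrow> d (a * b) = d a * b + a * d b"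
  and d_nilpotent: "a \<in> R \<Longrightarrow> \<exists>k. (d ^^ k) a = 0"
  using d unfolding LND_def by auto

lemma d_zero: "d 0 = 0"
  using d_scale[OF R_one, of 0] by (simp add: zero_fun_def times_fun_def)

lemma d_pow_zero: "(d ^^ k) 0 = 0"
  by (induction k) (simp_all only: funpow.simps id_apply comp_apply d_zero)

lemma d_one: "d (restr 1) = 0"
proof -
  have idem: "restr 1 * restr 1 = restr 1" by (auto simp: restr_def fun_eq_iff)
  have "d (restr 1) = d (restr 1) * restr 1 + restr 1 * d (restr 1)"
    using d_mult[OF R_one R_one] by (simp add: idem)
  then have "d (restr 1) x = 2 * d (restr 1) x" if "x \<in> X" for x
    using that by (auto simp: fun_eq_iff restr_def dest: spec[of _ x])
  then show ?thesis
    using R_outside[OF d_in[OF R_one]] by (force simp: fun_eq_iff)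
qed

lemma d_pow_in: "a \<in> R \<Longrightarrow> (d ^^ k) a \<in> R"
  by (induction k) (auto simp: d_in)

lemma d_pow_add: "a \<in> R \<Longrightarrow> b \<in> R \<Longrightarrow> (d ^^ k) (a + b) = (d ^^ k) a + (d ^^ k) b"
  by (induction k) (auto simp: d_add d_pow_in)

definition height :: "('p \<Rightarrow> complex) \<Rightarrow> nat" where
  "height a = (LEAST k. (d ^^ k) a = 0)"

lemma height:
  assumes "a \<in> R" "k \<ge> height a"
  shows "(d ^^ k) a = 0"
proof -
  have "(d ^^ height a) a = 0" unfolding height_def using d_nilpotent[OF assms(1)] by (rule LeastI_ex)
  moreover have "(d ^^ k) a = (d ^^ (k - height a)) ((d ^^ height a) a)"
    using assms(2) by (metis comp_apply funpow_add le_add_diff_inverse2)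
  ultimately show ?thesis by (simp add: d_pow_zero)
qed

text \<open>The exponential series \<open>exp (t d) a\<close>, evaluated at the point \<open>x\<close>, as a polynomial in \<open>t\<close>.\<close>

definition exp_poly :: "('p \<Rightarrow> complex) \<Rightarrow> 'p \<Rightarrow> complex poly" where
  "exp_poly a x = (\<Sum>k<height a. monom ((d ^^ k) a x / fact k) k)"

lemma coeff_exp_poly:
  assumes "a \<in> R"
  shows "coeff (exp_poly a x) k = (d ^^ k) a x / fact k"
  using height[OF assms, of k] by (simp add: exp_poly_def coeff_sum coeff_monom sum.delta')

lemma exp_poly_add: "a \<in> R \<Longrightarrow> b \<in> R \<Longrightarrow> exp_poly (a + b) x = exp_poly a x + exp_poly b x"
  by (simp add: poly_eq_iff coeff_exp_poly R_add d_pow_add add_divide_distrib)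

lemma pderiv_exp_poly: "a \<in> R \<Longrightarrow> pderiv (exp_poly a x) = exp_poly (d a) x"
  by (simp add: poly_eq_iff coeff_pderiv coeff_exp_poly d_in funpow_swap1 field_simps del: of_nat_Suc)

text \<open>Induction on the coefficient index, for all \<open>a\<close> and \<open>b\<close> at
  once: passing to the derivative in \<open>t\<close> replaces the product by
  \<open>d a * b + a * d b\<close>, so the product rule alone replaces the binomial form of the
  Leibniz rule.\<close>

lemma exp_poly_mult:
  assumes "a \<in> R" "b \<in> R"
  shows "exp_poly (a * b) x = exp_poly a x * exp_poly b x"
proof (rule poly_eqI)
  fix k show "coeff (exp_poly (a * b) x) k = coeff (exp_poly a x * exp_poly b x) k"
    using assms
  proof (induction k arbitrary: a b)
    case 0
    have "coeff (exp_poly (a * b) x) 0 = a x * b x"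
      unfolding coeff_exp_poly[OF R_mult[OF 0]] by simp
    then show ?case using 0 by (simp only: coeff_mult) (simp add: coeff_exp_poly)
  next
    case (Suc k)
    have "of_nat (Suc k) * coeff (exp_poly (a * b) x) (Suc k) = coeff (pderiv (exp_poly (a * b) x)) k"
      by (simp add: coeff_pderiv)
    also have "\<dots> = coeff (exp_poly (d a * b) x) k + coeff (exp_poly (a * d b) x) k"
      unfolding pderiv_exp_poly[OF R_mult[OF Suc.prems]] d_mult[OF Suc.prems]
        exp_poly_add[OF R_mult[OF d_in[OF Suc.prems(1)] Suc.prems(2)] R_mult[OF Suc.prems(1) d_in[OF Suc.prems(2)]]]
      by simp
    also have "\<dots> = coeff (exp_poly (d a) x * exp_poly b x) k + coeff (exp_poly a x * exp_poly (d b) x) k"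
      unfolding Suc.IH[OF d_in[OF Suc.prems(1)] Suc.prems(2)] Suc.IH[OF Suc.prems(1) d_in[OF Suc.prems(2)]] ..
    also have "\<dots> = coeff (pderiv (exp_poly a x * exp_poly b x)) k"
      using Suc.prems by (simp add: pderiv_mult pderiv_exp_poly mult.commute)
    also have "\<dots> = of_nat (Suc k) * coeff (exp_poly a x * exp_poly b x) (Suc k)"
      by (simp add: coeff_pderiv)
    finally show ?case by (simp add: times_fun_def del: of_nat_Suc)
  qed
qed

lemma exp_poly_const:
  assumes "x \<in> X"
  shows "exp_poly (restr (\<lambda>_. c)) x = [:c:]"
proof (rule poly_eqI)
  have R: "restr (\<lambda>_. c) \<in> R" by (intro R_restr polynomial_functions.const)
  have "d (restr (\<lambda>_. c)) = 0"
    unfolding restr_const[of c] d_scale[OF R_one] d_one by (simp add: fun_eq_iff)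
  then have pow: "(d ^^ Suc k) (restr (\<lambda>_. c)) = 0" for k
    by (simp only: funpow_Suc_right comp_apply d_pow_zero)
  show "coeff (exp_poly (restr (\<lambda>_. c)) x) k = coeff [:c:] k" for k
  proof (cases k)
    case 0
    then show ?thesis
      unfolding coeff_exp_poly[OF R] using assms by (simp add: restr_def)
  next
    case (Suc j)
    then show ?thesis unfolding coeff_exp_poly[OF R] Suc pow by simp
  qed
qed

text \<open>\<open>exp (t d)\<close> followed by evaluation at \<open>x\<close> is an algebra
  homomorphism, hence determined by its values on the coordinates.\<close>

lemma exp_poly_point:
  assumes "x \<in> X" and y: "\<And>k. k \<in> K \<Longrightarrow> k y = poly (exp_poly (restr k) x) t"
    and "f \<in> polynomial_functions K"
  shows "f y = poly (exp_poly (restr f) x) t"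
  using assms(3)
proof induction
  case (const c)
  then show ?case using assms(1) by (simp add: exp_poly_const)
next
  case (coord f)
  then show ?case by (rule y)
next
  case (add f h)
  then show ?case unfolding restr_add exp_poly_add[OF add(1,2)[THEN R_restr]] by simp
next
  case (mult f h)
  then show ?case unfolding restr_mult exp_poly_mult[OF mult(1,2)[THEN R_restr]] by simp
qed

text \<open>Applied to the equations of \<open>X\<close>, this shows that the exponential keeps
  points of \<open>X\<close> in \<open>X\<close>.\<close>

lemma exp_poly_vanishing:
  assumes "x \<in> X" and "\<And>k. k \<in> K \<Longrightarrow> k y = poly (exp_poly (restr k) x) t"
    and "f \<in> polynomial_functions K" and "\<And>x. x \<in> X \<Longrightarrow> f x = 0"
  shows "f y = 0"
proof -
  have "restr f = restr (\<lambda>_. 0)" using assms(4) by (auto simp: restr_def)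
  then show ?thesis using exp_poly_point[OF assms(1-3)] exp_poly_const[OF assms(1), of 0] by simp
qed

lemma exp_polynomial_flow:
  assumes in_X: "\<And>x t. x \<in> X \<Longrightarrow> \<Phi> t x \<in> X"
    and coords: "\<And>x t k. x \<in> X \<Longrightarrow> k \<in> K \<Longrightarrow> k (\<Phi> t x) = poly (exp_poly (restr k) x) t"
    and sep: "\<And>x y. (\<And>k. k \<in> K \<Longrightarrow> k x = k y) \<Longrightarrow> x = y"
  obtains C where "polynomial_flow K X \<Phi> C"
    "\<And>f x. f \<in> polynomial_functions K \<Longrightarrow> x \<in> X \<Longrightarrow> C f x = exp_poly (restr f) x"
proof -
  have "\<exists>h\<in>polynomial_functions K. \<forall>x\<in>X. (d ^^ k) (restr f) x / fact k = h x"
    if "f \<in> polynomial_functions K" for f k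
  proof -
    obtain h where h: "h \<in> polynomial_functions K" "(d ^^ k) (restr f) = restr h"
      using d_pow_in[OF R_restr[OF \<open>f \<in> polynomial_functions K\<close>], of k] unfolding R_iff by blast
    then show ?thesis
      using polynomial_functions_mult[OF polynomial_functions_const[of "1 / fact k"] h(1)]
      by (intro bexI[of _ "\<lambda>x. 1 / fact k * h x"]) (auto simp: restr_def)
  qed
  then obtain h where h: "\<And>f k. f \<in> polynomial_functions K \<Longrightarrow> h f k \<in> polynomial_functions K"
    "\<And>f k x. f \<in> polynomial_functions K \<Longrightarrow> x \<in> X \<Longrightarrow> (d ^^ k) (restr f) x / fact k = h f k x"
    by metis
  \<comment> \<open>Regular functions are zero outside \<open>X\<close>, so \<open>exp_poly\<close>
    need not be polynomial in the point. The polynomial representatives \<open>h f k\<close> of its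
    coefficients give a version that is, and that agrees with it on \<open>X\<close>.\<close>
  define C where "C f x = (\<Sum>k<height (restr f). monom (h f k x) k)" for f x
  have C: "C f x = exp_poly (restr f) x" if "f \<in> polynomial_functions K" "x \<in> X" for f x
    using h(2)[OF that] by (simp add: C_def exp_poly_def)
  have "polynomial_flow K X \<Phi> C"
  proof
    show "\<Phi> t p \<in> X" if "p \<in> X" for t p using in_X that .
    show "\<Phi> 0 p = p" if "p \<in> X" for p
    proof (rule sep)
      show "k (\<Phi> 0 p) = k p" if "k \<in> K" for k
        using coords[OF \<open>p \<in> X\<close> that, of 0] coeff_exp_poly[OF R_restr[OF polynomial_functions.coord[OF that]], of p 0]
          \<open>p \<in> X\<close> by (simp add: poly_0_coeff_0 restr_def)
    qed
    fix f assume f: "f \<in> polynomial_functions K"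
    show "polynomial_family K (C f)"
      unfolding polynomial_family_def
    proof (intro conjI allI exI)
      show "degree (C f p) \<le> height (restr f)" for p
        unfolding C_def by (intro degree_sum_le) (auto intro: order_trans[OF degree_monom_le])
      show "(\<lambda>p. coeff (C f p) k) \<in> polynomial_functions K" for k
        using h(1)[OF f, of k] by (cases "k < height (restr f)") (simp_all add: C_def coeff_sum coeff_monom sum.delta')
    qed
    fix p t assume p: "p \<in> X"
    show eq: "f (\<Phi> t p) = poly (C f p) t"
      using exp_poly_point[OF p coords[OF p] f] by (simp add: C[OF f p])
    \<comment> \<open>\<open>f1\<close> represents the derivative of \<open>f\<close> along
      \<open>d\<close>; it links the time derivative of the orbit polynomial to the linear
      coefficient at the moved point.\<close>
    obtain f1 where f1: "f1 \<in> polynomial_functions K" "d (restr f) = restr f1"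
      using d_in[OF R_restr[OF f]] unfolding R_iff by blast
    have "poly (pderiv (C f p)) t = f1 (\<Phi> t p)"
      using exp_poly_point[OF p coords[OF p] f1(1)]
      by (simp add: C[OF f p] pderiv_exp_poly R_restr f f1(2))
    also have "\<dots> = coeff (C f (\<Phi> t p)) 1"
      using in_X[OF p, of t] by (simp add: C[OF f in_X[OF p]] coeff_exp_poly R_restr f f1(2)) (simp add: restr_def)
    finally show "poly (pderiv (C f p)) t = coeff (C f (\<Phi> t p)) 1" .
  qed
  then show thesis using that C by blast
qed

end

text \<open>Guarantees that the intersection defining \<open>makar_limanov\<close> is over a
  nonempty family, so that it lies in the ring of regular functions.\<close>

lemma zero_LND: "(\<lambda>_. 0) \<in> LND (regular_functions K X)"
proof -
  have "0 \<in> regular_functions K X"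
    unfolding regular_functions_def
    by (rule image_eqI[OF _ polynomial_functions.const[of 0]]) (auto simp: fun_eq_iff)
  moreover have "\<exists>k. ((\<lambda>_. 0) ^^ k) a = (0 :: 'a \<Rightarrow> complex)" for a :: "'a \<Rightarrow> complex"
    by (rule exI[of _ "Suc 0"]) (simp add: fun_eq_iff)
  ultimately show ?thesis
    unfolding LND_def mem_Collect_eq by (intro conjI ballI allI) (auto simp: fun_eq_iff)
qed

section \<open>Actions and derivations on the fibre\<close>

context commutator_fiber
begin

lemma action_trivial:
  assumes "additive_action matrix_pair_coords X \<phi>" "p \<in> X"
  shows "\<phi> t p = p"
proof -
  obtain C where "polynomial_flow matrix_pair_coords X \<phi> C"
    using additive_action_polynomial_flow[OF assms(1)] by blast
  then interpret commutator_fiber_flow n m g \<alpha> \<beta> \<alpha>' \<beta>' \<phi> C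
    by (intro commutator_fiber_flow.intro commutator_fiber_axioms)
  show ?thesis using flow_trivial[OF assms(2)] .
qed

lemma derivation_trivial:
  assumes "d \<in> LND (regular_functions matrix_pair_coords X)"
    and a: "a \<in> regular_functions matrix_pair_coords X"
  shows "d a = 0"
proof -
  interpret nilpotent_derivation matrix_pair_coords X d
    by (unfold_locales) (rule assms(1))
  \<comment> \<open>The point whose coordinates are the exponentials of the coordinate functions at
    \<open>x\<close>.\<close>
  define \<Phi> where "\<Phi> t x = ((\<chi> i j. poly (exp_poly (restr (\<lambda>p. fst p $ i $ j)) x) t) :: complex^2^2,
      (\<chi> i j. poly (exp_poly (restr (\<lambda>p. snd p $ i $ j)) x) t) :: complex^2^2)" for t x
  have coords: "k (\<Phi> t x) = poly (exp_poly (restr k) x) t" if "k \<in> matrix_pair_coords" for k x t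
    using that by (auto simp: matrix_pair_coords_def \<Phi>_def case_prod_unfold)
  have in_X: "\<Phi> t x \<in> X" if "x \<in> X" for x t
  proof -
    have van: "f (\<Phi> t x) = 0" if "f \<in> PF" "\<And>x. x \<in> X \<Longrightarrow> f x = 0" for f
      using exp_poly_vanishing[OF \<open>x \<in> X\<close> coords that] .
    have "(\<lambda>p. det (fst p) - 1) \<in> PF" "(\<lambda>p. det (snd p) - 1) \<in> PF"
      unfolding det_2 by (intro polynomial_functions_diff polynomial_functions_mult
          polynomial_functions_entries polynomial_functions_const)+
    from this[THEN van] have "det (fst (\<Phi> t x)) - 1 = 0" "det (snd (\<Phi> t x)) - 1 = 0"
      by (simp_all only: mem_X diff_self)
    moreover have "(A (\<Phi> t x) ** B (\<Phi> t x)) $ i $ j - (g ** (B (\<Phi> t x) ** A (\<Phi> t x))) $ i $ j = 0" for i j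
    proof -
      have "(\<lambda>p. (A p ** B p) $ i $ j - (g ** (B p ** A p)) $ i $ j) \<in> PF"
        unfolding mult_2_component
        by (intro polynomial_functions_diff polynomial_functions_add polynomial_functions_mult
            PF_A PF_B polynomial_functions_const)
      from this[THEN van] show ?thesis by (simp only: mem_X diff_self)
    qed
    ultimately have "det (fst (\<Phi> t x)) = 1" "det (snd (\<Phi> t x)) = 1"
      "\<And>i j. (A (\<Phi> t x) ** B (\<Phi> t x)) $ i $ j = (g ** (B (\<Phi> t x) ** A (\<Phi> t x))) $ i $ j"
      unfolding right_minus_eq by blast+
    then show ?thesis by (simp add: mem_X vec_eq_iff)
  qed
  have sep: "x = y" if "\<And>k. k \<in> matrix_pair_coords \<Longrightarrow> k x = k y" for x y
  proof -
    have "fst x $ i $ j = fst y $ i $ j" "snd x $ i $ j = snd y $ i $ j" for i j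
      using that[of "\<lambda>(x, y). x $ i $ j"] that[of "\<lambda>(x, y). y $ i $ j"]
      by (auto simp: matrix_pair_coords_def case_prod_beta)
    then show ?thesis by (simp add: prod_eq_iff vec_eq_iff)
  qed
  obtain C where flow: "polynomial_flow matrix_pair_coords X \<Phi> C"
    and C: "\<And>f x. f \<in> PF \<Longrightarrow> x \<in> X \<Longrightarrow> C f x = exp_poly (restr f) x"
    using exp_polynomial_flow[OF in_X coords sep] by blast
  interpret commutator_fiber_flow n m g \<alpha> \<beta> \<alpha>' \<beta>' \<Phi> C
    by (intro commutator_fiber_flow.intro commutator_fiber_axioms flow)
  obtain f where f: "f \<in> PF" "a = restr f" using a unfolding R_iff by blast
  have "d a x = 0" for x
  proof (cases "x \<in> X")
    case True
    \<comment> \<open>Triviality of the flow makes the orbit polynomial constant, and its linear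
      coefficient is \<open>d a x\<close>.\<close>
    have "C f x = [:f x:]"
      using flow_poly[OF f(1) True] flow_trivial[OF True] by (intro poly_ext) simp
    then have "coeff (exp_poly a x) 1 = 0" using C[OF f(1) True] f(2) by simp
    then show ?thesis using coeff_exp_poly[OF a, of x 1] by simp
  next
    case False
    then show ?thesis using R_outside[OF d_in[OF a]] by simp
  qed
  then show ?thesis by (simp add: fun_eq_iff)
qed

end

theorem theorem1p2:
  fixes n m :: int and g :: "complex^2^2" and \<alpha> :: complex
  assumes "n \<noteq> 0" and "m \<noteq> 0"
    and "g \<in> carrier SL2" and "trace g = \<alpha>"
    and "\<alpha> \<noteq> 2" and "\<alpha> \<noteq> - 2"
  shows "makar_limanov matrix_pair_coords (word_fiber n m g)
           = regular_functions matrix_pair_coords (word_fiber n m g)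
         \<and> (\<forall>\<phi>. additive_action matrix_pair_coords (word_fiber n m g) \<phi>
              \<longrightarrow> (\<forall>t. \<forall>p \<in> word_fiber n m g. \<phi> t p = p))"
proof -
  obtain \<beta> \<gamma> \<beta>' \<gamma>' where "SL2_power_polys n \<beta> \<gamma>" "SL2_power_polys m \<beta>' \<gamma>'"
    using SL2_power_polys_exist by metis
  then interpret commutator_fiber n m g \<beta> \<gamma> \<beta>' \<gamma>'
    using assms by unfold_locales (auto simp: SL2_carrier)
  have "makar_limanov matrix_pair_coords X = regular_functions matrix_pair_coords X"
    unfolding makar_limanov_def using derivation_trivial zero_LND by blast
  then show ?thesis using action_trivial by blast
qed

end
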